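(* Let $f$ be a bounded harmonic function on $\mathbb{D}$ of the form $f(z)=f_1(z)+\bar{z}^{m}\,\overline{f_2(z)}$, where $m$ is a positive integer, $f_1$ is a non-constant holomorphic polynomial and $f_2$ is a holomorphic function on $\mathbb{D}$ with $f_2(0)\neq 0$. Let $g\in L^1(\mathbb{D})$ be a right-terminating function such that $T_g$ is bounded and $[T_g,T_f]=0$ on $A^2(\mathbb{D})$. If either $m\geq 3$ or $g$ is bounded, then $g=af+b$ for some $a,b\in\mathbb{C}$.
   Context: $\mathbb{D}$ is the open unit disk in $\mathbb{C}$ and $dA$ is the normalized Lebesgue area measure on $\mathbb{D}$ (total mass $1$); $L^1(\mathbb{D})$ and $L^2(\mathbb{D})$ are taken with respect to $dA$. The Bergman space $A^2(\mathbb{D})$ is the closed subspace of $L^2(\mathbb{D})$ consisting of holomorphic functions, and $P:L^2(\mathbb{D})\to A^2(\mathbb{D})$ is the orthogonal projection. Toeplitz operators: for $f\in L^\infty(\mathbb{D})$, $T_f:A^2(\mathbb{D})\to A^2(\mathbb{D})$ is the bounded operator $T_f(h)=P(fh)$, equivalently $T_f(h)(z)=\int_{\mathbb{D}}\frac{f(w)h(w)}{(1-\bar{w}z)^2}\,dA(w)$ for $z\in\mathbb{D}$. For a general symbol $g\in L^1(\mathbb{D})$, $T_g$ is defined by the same integral formula $T_g(h)(z)=\int_{\mathbb{D}}\frac{g(w)h(w)}{(1-\bar{w}z)^2}\,dA(w)$ for those $h\in A^2(\mathbb{D})$ for which the integral exists (for example, all bounded holomorphic $h$, in particular all polynomials).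 "$T_g$ is bounded" means that $T_g$, so defined on bounded holomorphic functions, extends to a bounded operator on $A^2(\mathbb{D})$, and $T_g$ then denotes this extension. $[A,B]=AB-BA$. Right-terminating: for $g\in L^1(\mathbb{D})$ and each integer $k$, put $g_k(r)=\frac{1}{2\pi}\int_0^{2\pi}g(re^{i\theta})e^{-ik\theta}\,d\theta$, defined for a.e. $r\in[0,1)$. The function $g\in L^1(\mathbb{D})$ is called right-terminating if there is an integer $n$ such that $g(re^{i\theta})=\sum_{k=-\infty}^{n}g_k(r)e^{ik\theta}$, where the series converges in $L^1(\mathbb{D})$. Equalities between elements of $L^1(\mathbb{D})$ are understood almost everywhere; "$g$ is bounded" means $g\in L^\infty(\mathbb{D})$. *)

theory Defs
  imports "HOL-Complex_Analysis.Complex_Analysis"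
begin

text \<open>
  Functions on the unit disc are modelled as total functions \<^typ>\<open>complex \<Rightarrow> complex\<close> whose values
  outside the disc are irrelevant: measures live on the disc, and elements of the Bergman space are
  only ever compared at points of the disc.
\<close>

abbreviation unit_disc :: "complex set"
  where "unit_disc \<equiv> ball 0 1"

definition disc_area :: "complex measure"
  where "disc_area = density (lebesgue_on unit_disc) (\<lambda>_. ennreal (1 / pi))"

lemma space_disc_area: "space disc_area = unit_disc"
  by (simp add: disc_area_def)

lemma emeasure_disc_area_total: "emeasure disc_area unit_disc = 1"
proof -
  have "emeasure disc_area unit_disc
      = ennreal (1 / pi) * emeasure (lebesgue_on unit_disc) unit_disc"
    unfolding disc_area_def
    by (subst emeasure_density)
       (auto simp: nn_integral_cmult_indicator sets_restrict_space_iff)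
  also have "emeasure (lebesgue_on unit_disc) unit_disc = ennreal pi"
    by (simp add: emeasure_restrict_space emeasure_ball unit_ball_vol_numeral)
  also have "ennreal (1 / pi) * ennreal pi = 1"
    by (simp flip: ennreal_mult)
  finally show ?thesis .
qed

definition harmonic_on :: "(complex \<Rightarrow> complex) \<Rightarrow> complex set \<Rightarrow> bool"
  where "harmonic_on f S \<longleftrightarrow>
    (\<exists>fx fy fxx fxy fyx fyy.
      (\<forall>z\<in>S.
        (f has_derivative (\<lambda>h. Re h *\<^sub>R fx z + Im h *\<^sub>R fy z)) (at z) \<and>
        (fx has_derivative (\<lambda>h. Re h *\<^sub>R fxx z + Im h *\<^sub>R fxy z)) (at z) \<and>
        (fy has_derivative (\<lambda>h. Re h *\<^sub>R fyx z + Im h *\<^sub>R fyy z)) (at z) \<and>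
        fxx z + fyy z = 0) \<and>
      continuous_on S fxx \<and> continuous_on S fxy \<and>
      continuous_on S fyx \<and> continuous_on S fyy)"

definition bergman_space :: "(complex \<Rightarrow> complex) set"
  where "bergman_space =
    {h. h holomorphic_on unit_disc \<and> integrable disc_area (\<lambda>z. (cmod (h z))\<^sup>2)}"

definition bergman_norm :: "(complex \<Rightarrow> complex) \<Rightarrow> real"
  where "bergman_norm h = sqrt (LINT z|disc_area. (cmod (h z))\<^sup>2)"

text \<open>
  The norm bound together with linearity makes such an operator well defined on restrictions to the
  disc: arguments that agree on the disc have images that agree on the disc.
\<close>

definition bounded_operator :: "((complex \<Rightarrow> complex) \<Rightarrow> (complex \<Rightarrow> complex)) \<Rightarrow> bool"
  where "bounded_operator S \<longleftrightarrow>
    (\<forall>h\<in>bergman_space. S h \<in> bergman_space) \<and>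
    (\<forall>h\<in>bergman_space. \<forall>k\<in>bergman_space. \<forall>a b. \<forall>z\<in>unit_disc.
       S (\<lambda>w. a * h w + b * k w) z = a * S h z + b * S k z) \<and>
    (\<exists>C. \<forall>h\<in>bergman_space. bergman_norm (S h) \<le> C * bergman_norm h)"

definition toeplitz :: "(complex \<Rightarrow> complex) \<Rightarrow> (complex \<Rightarrow> complex) \<Rightarrow> complex \<Rightarrow> complex"
  where "toeplitz g h z = (LINT w|disc_area. g w * h w / (1 - cnj w * z)\<^sup>2)"

text \<open>
  For an integrable symbol the integral is only guaranteed to exist for bounded holomorphic
  arguments. Polynomials being dense in the Bergman space, at most one bounded operator (up to values
  outside the disc) has the following property; it is the Toeplitz operator with symbol \<open>g\<close>, and
  that operator is bounded precisely if such an \<open>S\<close> exists.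
\<close>

definition is_toeplitz_extension ::
    "(complex \<Rightarrow> complex) \<Rightarrow> ((complex \<Rightarrow> complex) \<Rightarrow> (complex \<Rightarrow> complex)) \<Rightarrow> bool"
  where "is_toeplitz_extension g S \<longleftrightarrow>
    bounded_operator S \<and>
    (\<forall>h. h holomorphic_on unit_disc \<longrightarrow> bounded (h ` unit_disc) \<longrightarrow>
       (\<forall>z\<in>unit_disc. S h z = toeplitz g h z))"

definition polar_coeff :: "(complex \<Rightarrow> complex) \<Rightarrow> int \<Rightarrow> real \<Rightarrow> complex"
  where "polar_coeff g k r =
    1 / (2 * pi) * (LINT t:{0..2 * pi}|lebesgue. g (of_real r * cis t) * cis (- (of_int k * t)))"

text \<open>The term \<open>g\<^sub>k(r) e\<^bsup>ik\<theta>\<^esup>\<close> at \<open>z = r e\<^bsup>i\<theta>\<^esup>\<close>.\<close>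

definition polar_term :: "(complex \<Rightarrow> complex) \<Rightarrow> int \<Rightarrow> complex \<Rightarrow> complex"
  where "polar_term g k z = polar_coeff g k (cmod z) * cis (of_int k * Arg z)"

definition right_terminating :: "(complex \<Rightarrow> complex) \<Rightarrow> bool"
  where "right_terminating g \<longleftrightarrow>
    integrable disc_area g \<and>
    (\<exists>n::int.
      (\<forall>k\<le>n. integrable disc_area (polar_term g k)) \<and>
      (\<lambda>N. LINT z|disc_area. cmod (g z - (\<Sum>k\<in>{- int N..n}. polar_term g k z)))
        \<longlonglongrightarrow> 0)"

definition essentially_bounded :: "(complex \<Rightarrow> complex) \<Rightarrow> bool"
  where "essentially_bounded g \<longleftrightarrow>
    g \<in> borel_measurable disc_area \<and> (\<exists>M. AE z in disc_area. cmod (g z) \<le> M)"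

end

theory Submission
  imports Defs
begin

text \<open>
  For integrable \<open>u\<close> let \<open>I\<^sub>u(j,l)\<close> be the integral of \<open>u w\<^sup>j cnj(w)\<^sup>l\<close> over the disc. Expanding
  the kernel \<open>1 / (1 - cnj(w) z)\<^sup>2\<close> shows that \<open>T\<^sub>u\<close> maps \<open>w\<^sup>j\<close> to the power series with coefficients
  \<open>(l + 1) I\<^sub>u(j,l)\<close>. So \<open>T\<^sub>u\<close> is an infinite matrix, and its entries determine \<open>u\<close> almost everywhere
  (lemma \<open>moment_free_AE_zero\<close>). Since \<open>g\<close> is right-terminating, the matrix of \<open>T\<^sub>g\<close> vanishes above
  some diagonal \<open>l - j = n\<close>. The matrix of \<open>T\<^sub>f\<close> is the sum of an analytic part, constant on each
  diagonal \<open>0, \<dots>, d\<close> with \<open>d\<close> the degree of the polynomial, and a co-analytic part that lives on the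
  diagonals \<open>l - j \<le> -m\<close>. Both operators therefore map monomials to polynomials, and commutation is a
  family of identities between finite sums.
  
  Compare the commutator diagonal by diagonal, from the top. As long as \<open>k > n - m - d\<close>, the
  co-analytic part does not contribute, and the identity says that the \<open>k\<close>-th diagonal of \<open>T\<^sub>g\<close> is
  periodic with period \<open>d\<close>. The diagonals of a Toeplitz matrix with integrable symbol vary slowly:
  consecutive entries have differences tending to \<open>0\<close> (lemma \<open>toeplitz_entry_slowly_varying\<close>). So
  these diagonals are constant, and they vanish for \<open>k < 0\<close>. On the critical diagonal
  \<open>n - m - d\<close> the top diagonal of \<open>T\<^sub>g\<close> meets the co-analytic part, and the result is a recurrence with
  right-hand side \<open>C (m/(j+1) - m/(j+n+1))\<close> for \<open>j \<ge> m - 1\<close> and \<open>C (1 - m/(j+n+1))\<close> for \<open>j < m\<close>,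
  where \<open>C\<close> is a nonzero multiple of the top diagonal. For every \<open>n > 0\<close> other
  than \<open>d\<close>, this recurrence is impossible with \<open>C \<noteq> 0\<close>:
  
  \<^item> If \<open>n < d\<close>, the entries along \<open>j = m - 1, m - 1 + d, \<dots>\<close> and along \<open>j = m, m + d, \<dots>\<close> are explicit
    sums, and neighbouring ones stay apart, against slow variation (lemma \<open>top_degree_not_below\<close>).
  
  \<^item> If \<open>n > d\<close> and \<open>m \<ge> 2\<close>, all entries involved are moments of one function with respect to powers of
    the squared modulus. Such an identity extends from exponents \<open>i \<ge> 1\<close> to the exponent \<open>0\<close>, as one sees
    by testing against \<open>(1 - x)\<^sup>N\<close> (lemma \<open>diagonal_moment_extrapolation\<close>). So the first formula also
    holds at \<open>j = m - 2\<close>, where it contradicts the second one. The function is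
    \<open>g w\<^bsup>m-2\<^esup> cnj(w)\<^bsup>n-d-2\<^esup>\<close>, whose second exponent may be \<open>-1\<close>; it is integrable if \<open>m \<ge> 3\<close> or \<open>g\<close> is
    bounded.
  
  \<^item> If \<open>n > d\<close> and \<open>m = 1\<close>, the recurrence holds for all \<open>j\<close>, and the obstruction is the pole of its
    right-hand side at \<open>j = -1\<close>. Testing against \<open>(1 - (1 - x)\<^sup>N) / x\<close> turns the right-hand side into
    partial sums of the harmonic series, while the left-hand side stays bounded for bounded \<open>g\<close>
    (lemma \<open>diagonal_moment_nonresonance\<close>).
  
  So the top diagonal can be removed unless \<open>n = d\<close> or \<open>n = 0\<close>. There it is constant, and subtracting a
  multiple of \<open>f\<close>, or a constant function, removes it and preserves all hypotheses. What remains
  has only negative diagonals, all of which vanish, so \<open>g - a f - b\<close> has no nonzero moment.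
\<close>

section \<open>Normalised area measure on the disc\<close>

text \<open>
  The identification of the plane with \<open>real^2\<close> preserves Lebesgue measure. It transports the
  invariance of Lebesgue measure under orthogonal maps to rotations \<open>w \<mapsto> c w\<close>.
\<close>

lemma lborel_complex_eq_distr_vec:
  "distr lborel borel (\<lambda>v::real^2. Complex (vec_nth v 1) (vec_nth v 2)) = (lborel :: complex measure)"
proof (rule lborel_eqI[symmetric])
  have meas: "(\<lambda>v::real^2. Complex (vec_nth v 1) (vec_nth v 2)) \<in> borel_measurable borel"
    by (intro borel_measurable_continuous_onI continuous_intros)
  have Basis2: "(Basis :: (real^2) set) = {axis 1 1, axis 2 1}"
    by (simp add: Basis_vec_def UNIV_2 insert_commute)
  fix l u :: complex assume le: "\<And>b. b \<in> Basis \<Longrightarrow> l \<bullet> b \<le> u \<bullet> b"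
  have Re: "Re l \<le> Re u" and Im: "Im l \<le> Im u"
    using le[of 1] le[of \<i>] by (auto simp: Basis_complex_def)
  define l' u' :: "real^2" where "l' = vector [Re l, Im l]" and "u' = vector [Re u, Im u]"
  have "(\<lambda>v::real^2. Complex (vec_nth v 1) (vec_nth v 2)) -` box l u = box l' u'"
    by (simp add: set_eq_iff mem_box_cart forall_2 l'_def u'_def in_box_complex_iff)
  moreover have "emeasure lborel (box l' u') = ennreal ((Re u - Re l) * (Im u - Im l))"
    using Re Im by (subst emeasure_lborel_box_eq)
      (simp add: Basis2 inner_axis l'_def u'_def axis_eq_axis)
  ultimately show "emeasure (distr lborel borel (\<lambda>v::real^2. Complex (vec_nth v 1) (vec_nth v 2))) (box l u)
      = ennreal (\<Prod>b\<in>Basis. (u - l) \<bullet> b)"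
    using meas by (simp add: emeasure_distr Basis_complex_def)
qed simp

lemma distr_lborel_rotation:
  fixes c :: complex
  assumes "cmod c = 1"
  shows "distr lborel borel ((*) c) = lborel"
proof -
  let ?\<phi> = "\<lambda>v::real^2. Complex (vec_nth v 1) (vec_nth v 2)"
  define T :: "real^2 \<Rightarrow> real^2"
    where "T v = vector [Re (c * ?\<phi> v), Im (c * ?\<phi> v)]" for v
  have \<phi>: "?\<phi> \<in> borel_measurable borel"
    by (intro borel_measurable_continuous_onI continuous_intros)
  have sq: "(Re c)\<^sup>2 + (Im c)\<^sup>2 = 1"
    using assms by (simp add: cmod_def)
  have "linear T"
    by (rule linearI) (simp_all add: T_def vec_eq_iff forall_2 algebra_simps)
  moreover have "norm (T v) = norm v" for v
  proof -
    have norm2: "(norm w)\<^sup>2 = (vec_nth w 1)\<^sup>2 + (vec_nth w 2)\<^sup>2" for w :: "real^2"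
      by (simp only: power2_norm_eq_inner) (simp add: inner_vec_def sum_2 power2_eq_square)
    have "(norm (T v))\<^sup>2 = ((Re c)\<^sup>2 + (Im c)\<^sup>2) * (norm v)\<^sup>2"
      unfolding norm2 by (simp add: T_def power2_eq_square algebra_simps)
    then show ?thesis by (simp add: sq)
  qed
  ultimately have orth: "orthogonal_transformation T"
    by (simp add: orthogonal_transformation)
  have Tm: "T \<in> borel_measurable borel"
    using \<open>linear T\<close> by (simp add: borel_measurable_continuous_onI linear_continuous_on linear_conv_bounded_linear)
  have inter: "c * ?\<phi> v = ?\<phi> (T v)" for v
    by (simp add: T_def complex_eq_iff)
  have dT: "distr lborel borel T = lborel"
  proof (rule lborel_eqI[symmetric])
    fix l u :: "real^2" assume le: "\<And>b. b \<in> Basis \<Longrightarrow> l \<bullet> b \<le> u \<bullet> b"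
    have T': "orthogonal_transformation (inv T)"
      using orth by (rule orthogonal_transformation_inv)
    have "T -` box l u = inv T ` box l u"
      using orth by (simp add: bij_vimage_eq_inv_image orthogonal_transformation_bij)
    then have eq: "emeasure lborel (T -` box l u) = emeasure lebesgue (inv T ` box l u)"
      using measurable_sets_borel[OF Tm, of "box l u"] by simp
    also have "\<dots> = ennreal (measure lebesgue (box l u))"
    proof -
      have "box l u \<in> lmeasurable" by (rule lmeasurable_box)
      from emeasure_eq_measure2[OF measurable_orthogonal_image[OF T' this]] measure_orthogonal_image[OF T' this]
      show ?thesis by simp
    qed
    finally show "emeasure (distr lborel borel T) (box l u) = ennreal (\<Prod>b\<in>Basis. (u - l) \<bullet> b)"
      using le Tm by (simp add: emeasure_distr measure_lborel_box_eq)
  qed simp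
  have "distr lborel borel ((*) c) = distr (distr lborel borel ?\<phi>) borel ((*) c)"
    by (simp add: lborel_complex_eq_distr_vec)
  also have "\<dots> = distr lborel borel (\<lambda>v. ?\<phi> (T v))"
    using \<phi> by (subst distr_distr) (simp_all add: o_def inter)
  also have "\<dots> = distr (distr lborel borel T) borel ?\<phi>"
    using \<phi> Tm by (subst distr_distr) (simp_all add: o_def)
  also have "\<dots> = lborel"
    by (simp add: dT lborel_complex_eq_distr_vec)
  finally show ?thesis .
qed

lemma distr_lebesgue_rotation:
  fixes c :: complex
  assumes "cmod c = 1"
  shows "(*) c \<in> lebesgue \<rightarrow>\<^sub>M lebesgue" and "distr lebesgue lebesgue ((*) c) = lebesgue"
proof -
  have eq: "distr lebesgue lborel ((*) c) = lborel"
    using distr_lborel_rotation[OF assms] by (simp add: distr_completion cong: distr_cong)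
  then show "(*) c \<in> lebesgue \<rightarrow>\<^sub>M lebesgue"
    by (intro completion.measurable_completion2) (simp_all add: measurable_completion)
  show "distr lebesgue lebesgue ((*) c) = lebesgue"
    using completion.completion_distr_eq[of "(*) c" lborel lborel] eq
    by (simp add: measurable_completion)
qed

lemma integral_disc_area:
  fixes h :: "complex \<Rightarrow> complex"
  assumes "h \<in> borel_measurable disc_area"
  shows "(LINT w|disc_area. h w) = (1/pi) *\<^sub>R (LINT w|lebesgue. indicator unit_disc w *\<^sub>R h w)"
  using assms unfolding disc_area_def
  by (subst integral_density) (simp_all add: integral_restrict_space)

text \<open>
  Invariance under rotations separates the angular frequencies of an integrand, without polar
  coordinates.
\<close>

lemma integral_disc_rotation:
  fixes h :: "complex \<Rightarrow> complex"
  assumes "h \<in> borel_measurable disc_area" and "cmod c = 1"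
  shows "(LINT w|disc_area. h (c * w)) = (LINT w|disc_area. h w)"
proof -
  have rot: "c * w \<in> unit_disc \<longleftrightarrow> w \<in> unit_disc" for w
    using assms(2) by (simp add: norm_mult)
  have hm: "(\<lambda>w. indicator unit_disc w *\<^sub>R h w) \<in> borel_measurable lebesgue"
    using assms(1) by (simp add: disc_area_def borel_measurable_restrict_space_iff)
  have hcm: "(\<lambda>w. indicator unit_disc w *\<^sub>R h (c * w)) \<in> borel_measurable lebesgue"
    using measurable_compose[OF distr_lebesgue_rotation(1)[OF assms(2)] hm] rot
    by (simp add: indicator_def)
  have hcd: "(\<lambda>w. h (c * w)) \<in> borel_measurable disc_area"
    using hcm by (simp add: disc_area_def borel_measurable_restrict_space_iff)
  have "(LINT w|lebesgue. indicator unit_disc w *\<^sub>R h w)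
     = (LINT w|distr lebesgue lebesgue ((*) c). indicator unit_disc w *\<^sub>R h w)"
    by (simp add: distr_lebesgue_rotation assms)
  also have "\<dots> = (LINT w|lebesgue. indicator unit_disc (c * w) *\<^sub>R h (c * w))"
    using hm distr_lebesgue_rotation(1)[OF assms(2)] by (subst integral_distr) simp_all
  also have "\<dots> = (LINT w|lebesgue. indicator unit_disc w *\<^sub>R h (c * w))"
    using rot by (simp add: indicator_def)
  finally have "(LINT w|lebesgue. indicator unit_disc w *\<^sub>R h w)
      = (LINT w|lebesgue. indicator unit_disc w *\<^sub>R h (c * w))" .
  then show ?thesis
    by (simp only: integral_disc_area[OF assms(1)] integral_disc_area[OF hcd])
qed

lemma disc_area_measurable_continuous:
  fixes h :: "complex \<Rightarrow> 'a::topological_space"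
  assumes "continuous_on unit_disc h"
  shows "h \<in> borel_measurable disc_area"
  using assms by (simp add: disc_area_def continuous_imp_measurable_on_sets_lebesgue)

lemma finite_measure_disc_area: "finite_measure disc_area"
  by (rule finite_measureI) (simp add: space_disc_area emeasure_disc_area_total)

lemma disc_bounded_integrable:
  fixes h :: "complex \<Rightarrow> 'a::{banach,second_countable_topology}"
  assumes "h \<in> borel_measurable disc_area" "\<And>w. w \<in> unit_disc \<Longrightarrow> norm (h w) \<le> B"
  shows "integrable disc_area h"
  using assms by (intro finite_measure.integrable_const_bound[OF finite_measure_disc_area, of _ B])
    (auto intro!: AE_I2 simp: space_disc_area)

lemma disc_bounded_mult_integrable:
  fixes h k :: "complex \<Rightarrow> complex"
  assumes h: "integrable disc_area h" and k: "k \<in> borel_measurable disc_area"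
    and B: "\<And>w. w \<in> unit_disc \<Longrightarrow> cmod (k w) \<le> B"
  shows "integrable disc_area (\<lambda>w. h w * k w)"
proof (rule Bochner_Integration.integrable_bound[of _ "\<lambda>w. B * norm (h w)"])
  show "integrable disc_area (\<lambda>w. B * norm (h w))" using h by simp
  show "(\<lambda>w. h w * k w) \<in> borel_measurable disc_area" using h k by measurable
  show "AE w in disc_area. norm (h w * k w) \<le> norm (B * norm (h w))"
  proof (rule AE_I2)
    fix w assume "w \<in> space disc_area"
    then have "cmod (k w) \<le> \<bar>B\<bar>"
      using B[of w] by (simp add: space_disc_area)
    then have "cmod (k w) * cmod (h w) \<le> \<bar>B\<bar> * cmod (h w)"
      by (intro mult_right_mono) auto
    then show "norm (h w * k w) \<le> norm (B * norm (h w))"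
      by (simp add: norm_mult abs_mult mult.commute)
  qed
qed

lemma continuous_closed_disc_bounded:
  fixes \<phi> :: "complex \<Rightarrow> 'a::real_normed_vector"
  assumes "continuous_on (cball 0 1) \<phi>"
  obtains B where "\<And>w. w \<in> unit_disc \<Longrightarrow> norm (\<phi> w) \<le> B"
proof -
  have "bounded (\<phi> ` cball 0 1)"
    using assms by (intro compact_imp_bounded compact_continuous_image) auto
  then obtain B where "\<And>w. w \<in> cball 0 1 \<Longrightarrow> norm (\<phi> w) \<le> B"
    by (metis bounded_iff imageI)
  then show thesis by (intro that[of B]) auto
qed

lemma continuous_closed_disc_integrable:
  fixes \<phi> :: "complex \<Rightarrow> 'a::{banach,second_countable_topology}"
  assumes "continuous_on (cball 0 1) \<phi>"
  shows "integrable disc_area \<phi>"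
proof -
  obtain B where "\<And>w. w \<in> unit_disc \<Longrightarrow> norm (\<phi> w) \<le> B"
    using continuous_closed_disc_bounded[OF assms] by blast
  then show ?thesis
    by (intro disc_bounded_integrable[of _ B] disc_area_measurable_continuous
        continuous_on_subset[OF assms]) auto
qed

lemma continuous_closed_disc_mult_integrable:
  fixes h \<phi> :: "complex \<Rightarrow> complex"
  assumes "integrable disc_area h" and "continuous_on (cball 0 1) \<phi>"
  shows "integrable disc_area (\<lambda>w. h w * \<phi> w)"
proof -
  obtain B where "\<And>w. w \<in> unit_disc \<Longrightarrow> cmod (\<phi> w) \<le> B"
    using continuous_closed_disc_bounded[OF assms(2)] by blast
  then show ?thesis
    by (intro disc_bounded_mult_integrable[OF assms(1), of _ B] disc_area_measurable_continuous
        continuous_on_subset[OF assms(2)]) auto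
qed

text \<open>
  The disc of radius \<open>r\<close> has normalised area \<open>r\<^sup>2\<close>, so the squared modulus is uniformly distributed on
  the unit interval. Hence powers of the squared modulus behave like powers of a real variable \<open>x\<close>.
\<close>

lemma distr_disc_area_norm_sq:
  "distr disc_area borel (\<lambda>w. (cmod w)\<^sup>2) = density lborel (indicator {0..1})"
proof (rule measure_eqI_lessThan)
  let ?X = "\<lambda>w. (cmod w)\<^sup>2"
  have meas [measurable]: "?X \<in> borel_measurable disc_area"
    by (intro disc_area_measurable_continuous continuous_intros)
  interpret finite_measure disc_area by (rule finite_measure_disc_area)
  interpret D: finite_measure "distr disc_area borel ?X"
    by (rule finite_measure_distr) simp
  show "emeasure (distr disc_area borel ?X) {x<..} < \<infinity>" for x
    using D.emeasure_finite[of "{x<..}"] by (metis infinity_ennreal_def top.not_eq_extremum)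
  fix x :: real
  have sq: "r\<^sup>2 < 1 \<longleftrightarrow> r < 1" if "r \<ge> 0" for r :: real
    using that by (simp add: power_less_one_iff abs_square_less_1)
  have R: "emeasure (density lborel (indicator {0..1})) {x<..} = emeasure lborel ({0..1} \<inter> {x<..})"
    by (simp add: emeasure_density flip: indicator_inter_arith)
  have L: "emeasure (distr disc_area borel ?X) {x<..} = emeasure disc_area (?X -` {x<..} \<inter> unit_disc)"
    by (simp add: emeasure_distr space_disc_area)
  consider "x < 0" | "0 \<le> x" "x < 1" | "x \<ge> 1" by linarith
  then show "emeasure (distr disc_area borel ?X) {x<..} = emeasure (density lborel (indicator {0..1})) {x<..}"
  proof cases
    case 1
    have "x < (cmod w)\<^sup>2" for w using 1 zero_le_power2[of "cmod w"] by linarith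
    then have "?X -` {x<..} \<inter> unit_disc = unit_disc" by auto
    moreover have "{0..1} \<inter> {x<..} = {0..1}" using 1 by auto
    ultimately show ?thesis unfolding L R by (simp add: emeasure_disc_area_total)
  next
    case 2
    let ?c = "cball 0 (sqrt x) :: complex set"
    have sub: "?c \<subseteq> unit_disc"
    proof -
      have "sqrt x < 1" using 2 by simp
      then show ?thesis by (force intro: le_less_trans)
    qed
    have "?X w > x \<longleftrightarrow> w \<notin> ?c" for w
      using 2 real_sqrt_less_iff[of x "?X w"] by (simp add: not_le)
    then have "?X -` {x<..} \<inter> unit_disc = unit_disc - ?c" by auto
    moreover have "emeasure disc_area ?c = ennreal x"
    proof -
      have "emeasure disc_area ?c = ennreal (1/pi) * emeasure (lebesgue_on unit_disc) ?c"
        unfolding disc_area_def using sub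
        by (subst emeasure_density) (auto simp: nn_integral_cmult_indicator sets_restrict_space_iff)
      also have "emeasure (lebesgue_on unit_disc) ?c = ennreal (pi * x)"
        using 2 sub by (simp add: emeasure_restrict_space emeasure_cball unit_ball_vol_numeral Int_absorb2)
      also have "ennreal (1/pi) * \<dots> = ennreal x"
        using 2 by (simp flip: ennreal_mult)
      finally show ?thesis .
    qed
    moreover have "emeasure disc_area (unit_disc - ?c) = emeasure disc_area unit_disc - emeasure disc_area ?c"
    proof (rule emeasure_Diff)
      show "emeasure disc_area ?c \<noteq> \<infinity>" by simp
    qed (use sub in \<open>auto simp: disc_area_def sets_restrict_space_iff\<close>)
    moreover have "{0..1} \<inter> {x<..} = {x<..1}" using 2 by auto
    ultimately show ?thesis
      using 2 unfolding L R by (simp add: emeasure_disc_area_total ennreal_minus flip: ennreal_1)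
  next
    case 3
    have "\<not> x < (cmod w)\<^sup>2" if "cmod w < 1" for w
      using 3 that sq[of "cmod w"] by simp
    then have "?X -` {x<..} \<inter> unit_disc = {}" by auto
    moreover have "{0..1} \<inter> {x<..} = {}" using 3 by auto
    ultimately show ?thesis unfolding L R by simp
  qed
qed simp_all

lemma integral_radial:
  fixes \<phi> :: "real \<Rightarrow> real"
  assumes [measurable]: "\<phi> \<in> borel_measurable borel"
  shows "(LINT w|disc_area. \<phi> ((cmod w)\<^sup>2)) = (LINT x|lborel. \<phi> x * indicator {0..1} x)"
    and "integrable disc_area (\<lambda>w. \<phi> ((cmod w)\<^sup>2)) \<longleftrightarrow> integrable lborel (\<lambda>x. \<phi> x * indicator {0..1} x)"
proof -
  have X [measurable]: "(\<lambda>w. (cmod w)\<^sup>2) \<in> borel_measurable disc_area"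
    by (intro disc_area_measurable_continuous continuous_intros)
  have eq: "density lborel (indicator {0..1::real}) = density lborel (\<lambda>x. ennreal (indicator {0..1} x))"
    by (intro density_cong) (auto simp: indicator_def)
  show "(LINT w|disc_area. \<phi> ((cmod w)\<^sup>2)) = (LINT x|lborel. \<phi> x * indicator {0..1} x)"
    using integral_distr[OF X assms] unfolding distr_disc_area_norm_sq eq
    by (subst (asm) integral_density) (simp_all add: mult.commute)
  show "integrable disc_area (\<lambda>w. \<phi> ((cmod w)\<^sup>2)) \<longleftrightarrow> integrable lborel (\<lambda>x. \<phi> x * indicator {0..1} x)"
    using integrable_distr_eq[OF X assms] unfolding distr_disc_area_norm_sq eq
    by (subst (asm) integrable_density) (simp_all add: mult.commute)
qed

lemma integral_norm_power:
  "(LINT w|disc_area. ((cmod w)\<^sup>2) ^ j) = 1 / (real j + 1)"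
  using integral_radial(1)[of "\<lambda>x. x ^ j"] by (simp add: integral_power)

lemma integral_one_minus_norm_sq_power:
  "(LINT w|disc_area. (1 - (cmod w)\<^sup>2) ^ j) = 1 / (real j + 1)"
proof -
  have "DERIV (\<lambda>x. - ((1 - x) ^ Suc j / real (Suc j))) x :> (1 - x) ^ j" for x :: real
  proof -
    have "DERIV (\<lambda>x. (1 - x) ^ Suc j) x :> real (Suc j) * (1 - x) ^ j * (0 - 1)"
      by (rule derivative_eq_intros refl)+ simp
    from DERIV_minus[OF DERIV_cdivide[OF this, of "real (Suc j)"]] show ?thesis
      by (simp del: of_nat_Suc)
  qed
  then have "(LINT x|lborel. (1 - x) ^ j * indicator {0..1} x)
      = - ((1 - 1) ^ Suc j / real (Suc j)) - - ((1 - 0) ^ Suc j / real (Suc j))"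
    by (rule integral_FTC_Icc_real[OF zero_le_one]) (intro continuous_intros)
  then show ?thesis
    using integral_radial(1)[of "\<lambda>x. (1 - x) ^ j"] by (simp add: add.commute)
qed

lemma AE_disc_nonzero: "AE w in disc_area. w \<noteq> 0"
proof -
  have "AE w in lebesgue_on unit_disc. w \<noteq> 0"
    by (rule AE_I[of _ _ "{0}"]) (auto simp: emeasure_restrict_space sets_restrict_space_iff)
  then show ?thesis
    unfolding disc_area_def by (subst AE_density) auto
qed

lemma integrable_inverse_norm: "integrable disc_area (\<lambda>w. inverse (cmod w))"
proof -
  have "(\<lambda>x::real. x powr (-1/2)) integrable_on {0..1}"
    by (rule integrable_on_powr_from_0) auto
  then have "(\<lambda>x::real. x powr (-1/2)) absolutely_integrable_on {0..1}"
    by (rule nonnegative_absolutely_integrable_1) auto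
  then have "integrable lebesgue (\<lambda>x. x powr (-1/2) * indicator {0..1::real} x)"
    by (simp add: set_integrable_def mult.commute)
  then have "integrable lborel (\<lambda>x. x powr (-1/2) * indicator {0..1::real} x)"
    by (subst (asm) integrable_completion) auto
  then have "integrable disc_area (\<lambda>w. ((cmod w)\<^sup>2) powr (-1/2))"
    by (subst integral_radial(2)) auto
  moreover have "((cmod w)\<^sup>2) powr (-1/2) = inverse (cmod w)" for w
  proof (cases "w = 0")
    case False
    have "((cmod w)\<^sup>2) powr (-1/2) = inverse (((cmod w)\<^sup>2) powr (1/2))"
      by (simp add: powr_minus)
    then show ?thesis by (simp add: powr_half_sqrt)
  qed simp
  ultimately show ?thesis by simp
qed

section \<open>Moments on the disc\<close>

definition disc_moment :: "(complex \<Rightarrow> complex) \<Rightarrow> nat \<Rightarrow> nat \<Rightarrow> complex"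
  where "disc_moment u j l = (LINT w|disc_area. u w * w ^ j * cnj w ^ l)"

lemma disc_monomial_bound: "w \<in> unit_disc \<Longrightarrow> cmod (w ^ j * cnj w ^ l) \<le> 1"
  by (simp add: norm_mult norm_power mult_le_one power_le_one)

lemma disc_monomial_measurable: "(\<lambda>w. w ^ j * cnj w ^ l) \<in> borel_measurable disc_area"
  by (intro disc_area_measurable_continuous continuous_intros)

lemma disc_moment_integrable:
  assumes "integrable disc_area u"
  shows "integrable disc_area (\<lambda>w. u w * w ^ j * cnj w ^ l)"
  using disc_bounded_mult_integrable[OF assms disc_monomial_measurable disc_monomial_bound]
  by (simp add: mult.assoc)

lemma disc_moment_add:
  "integrable disc_area u \<Longrightarrow> integrable disc_area v \<Longrightarrow>
    disc_moment (\<lambda>w. u w + v w) j l = disc_moment u j l + disc_moment v j l"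
  unfolding disc_moment_def by (simp add: distrib_right disc_moment_integrable)

lemma disc_moment_cmult: "disc_moment (\<lambda>w. c * u w) j l = c * disc_moment u j l"
  unfolding disc_moment_def by (simp add: mult.assoc)

lemma disc_moment_diff:
  "integrable disc_area u \<Longrightarrow> integrable disc_area v \<Longrightarrow>
    disc_moment (\<lambda>w. u w - v w) j l = disc_moment u j l - disc_moment v j l"
  unfolding disc_moment_def by (simp add: left_diff_distrib disc_moment_integrable)

lemma disc_moment_sum:
  assumes "\<And>i. i \<in> I \<Longrightarrow> integrable disc_area (u i)"
  shows "disc_moment (\<lambda>w. \<Sum>i\<in>I. u i w) j l = (\<Sum>i\<in>I. disc_moment (u i) j l)"
  unfolding disc_moment_def
  by (simp add: sum_distrib_right disc_moment_integrable assms)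

lemma disc_moment_times_monomial:
  "disc_moment (\<lambda>w. u w * (w ^ i * cnj w ^ k)) j l = disc_moment u (j + i) (l + k)"
  unfolding disc_moment_def by (simp add: power_add mult_ac)

lemma disc_moment_norm_le:
  assumes "integrable disc_area u"
  shows "cmod (disc_moment u j l) \<le> (LINT w|disc_area. cmod (u w))"
proof -
  have "cmod (disc_moment u j l) \<le> (LINT w|disc_area. cmod (u w * w ^ j * cnj w ^ l))"
    unfolding disc_moment_def by (rule integral_norm_bound)
  also have "\<dots> \<le> (LINT w|disc_area. cmod (u w))"
  proof (rule integral_mono)
    show "cmod (u w * w ^ j * cnj w ^ l) \<le> cmod (u w)" if "w \<in> space disc_area" for w
      using disc_monomial_bound[of w j l] that
      by (simp add: space_disc_area norm_mult mult.assoc mult_left_le)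
  qed (use assms disc_moment_integrable in auto)
  finally show ?thesis .
qed

text \<open>
  Rotate by an angle for which the integrand changes sign; this is possible as soon as its total
  angular frequency \<open>k + j - l\<close> is nonzero.
\<close>

lemma disc_moment_homogeneous:
  assumes meas: "u \<in> borel_measurable disc_area"
    and hom: "\<And>c w. cmod c = 1 \<Longrightarrow> w \<noteq> 0 \<Longrightarrow> u (c * w) = c powi k * u w"
    and ne: "k \<noteq> int l - int j"
  shows "disc_moment u j l = 0"
proof -
  define n where "n = k + int j - int l"
  have "n \<noteq> 0" using ne by (simp add: n_def)
  \<comment> \<open>With this rotation the integrand is multiplied by \<open>c\<^bsup>n\<^esup> = -1\<close>.\<close>
  define c where "c = cis (pi / of_int n)"
  have c: "cmod c = 1" by (simp add: c_def)
  have "c powi n = -1"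
    using \<open>n \<noteq> 0\<close> by (simp add: c_def cis_power_int)
  moreover have "c powi n = c powi k * c ^ j * cnj c ^ l"
  proof -
    have "cnj c = inverse c" using c by (simp add: inverse_complex_def cmod_def) (simp add: complex_eq_iff)
    moreover have "c \<noteq> 0" using c by auto
    ultimately show ?thesis
      by (simp add: n_def power_int_add power_int_diff divide_inverse power_inverse)
  qed
  ultimately have c1: "c powi k * c ^ j * cnj c ^ l = -1" by simp
  define v where "v w = (if w = 0 then 0 else u w * (w ^ j * cnj w ^ l))" for w
  have v: "v \<in> borel_measurable disc_area"
    unfolding v_def
  proof (rule measurable_If)
    show "{w \<in> space disc_area. w = 0} \<in> sets disc_area"
      by (auto simp: disc_area_def sets_restrict_space_iff intro!: sets.sets_into_space)
    show "(\<lambda>w. u w * (w ^ j * cnj w ^ l)) \<in> borel_measurable disc_area"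
      using meas disc_monomial_measurable by measurable
  qed simp
  have "v (c * w) = - v w" for w
  proof (cases "w = 0")
    case False
    have "u (c * w) * ((c * w) ^ j * cnj (c * w) ^ l)
        = (c powi k * c ^ j * cnj c ^ l) * (u w * (w ^ j * cnj w ^ l))"
      using hom[OF c False] by (simp add: power_mult_distrib mult_ac)
    moreover have "c \<noteq> 0" using c by auto
    ultimately show ?thesis using False by (simp add: v_def c1)
  qed (simp add: v_def)
  then have "(LINT w|disc_area. v w) = - (LINT w|disc_area. v w)"
    using integral_disc_rotation[OF v c] by simp
  moreover have "disc_moment u j l = (LINT w|disc_area. v w)"
    unfolding disc_moment_def
  proof (rule integral_cong_AE)
    show "(\<lambda>w. u w * w ^ j * cnj w ^ l) \<in> borel_measurable disc_area"
      using borel_measurable_times[OF meas disc_monomial_measurable] by (simp add: mult.assoc)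
    show "AE w in disc_area. u w * w ^ j * cnj w ^ l = v w"
      using AE_disc_nonzero by eventually_elim (simp add: v_def mult.assoc)
  qed (rule v)
  ultimately show ?thesis by simp
qed

lemma disc_moment_one: "disc_moment (\<lambda>_. 1) j l = (if j = l then 1 / (of_nat j + 1) else 0)"
proof (cases "j = l")
  case True
  have "disc_moment (\<lambda>_. 1) j j = (LINT w|disc_area. complex_of_real (((cmod w)\<^sup>2) ^ j))"
    unfolding disc_moment_def by (simp flip: power_mult_distrib complex_norm_square)
  then show ?thesis
    using True by (simp only: integral_complex_of_real integral_norm_power) simp
next
  case False
  then show ?thesis
    using disc_moment_homogeneous[of "\<lambda>_. 1" 0 l j] by simp
qed

lemma polar_term_rotation:
  assumes "cmod c = 1" "w \<noteq> 0"
  shows "polar_term g k (c * w) = c powi k * polar_term g k w"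
proof -
  have cis: "cis (of_int k * Arg z) = sgn z powi k" if "z \<noteq> 0" for z
    using that by (simp add: cis_power_int mult.commute flip: cis_Arg)
  have "c \<noteq> 0" using assms by auto
  then show ?thesis
    using assms by (simp add: polar_term_def cis norm_mult sgn_mult power_int_mult_distrib)
      (simp add: sgn_div_norm)
qed

text \<open>
  Only the polar term of frequency \<open>l - j\<close> can contribute to the moment with indices \<open>j\<close> and \<open>l\<close>, and
  moments are continuous for convergence in the mean.
\<close>

lemma right_terminating_moment_eq_0:
  assumes "right_terminating g"
  obtains n where "\<And>j l. int l - int j > n \<Longrightarrow> disc_moment g j l = 0"
proof -
  from assms obtain n where g: "integrable disc_area g"
    and int: "\<And>k. k \<le> n \<Longrightarrow> integrable disc_area (polar_term g k)"
    and lim: "(\<lambda>N. LINT z|disc_area. cmod (g z - (\<Sum>k\<in>{- int N..n}. polar_term g k z))) \<longlonglongrightarrow> 0"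
    unfolding right_terminating_def by blast
  have "disc_moment g j l = 0" if jl: "int l - int j > n" for j l
  proof -
    have "cmod (disc_moment g j l) \<le> (LINT z|disc_area. cmod (g z - (\<Sum>k\<in>{- int N..n}. polar_term g k z)))"
      for N
    proof -
      let ?s = "\<lambda>z. \<Sum>k\<in>{- int N..n}. polar_term g k z"
      have s: "integrable disc_area ?s" using int by auto
      have "disc_moment ?s j l = (\<Sum>k\<in>{- int N..n}. disc_moment (polar_term g k) j l)"
        using int by (intro disc_moment_sum) auto
      also have "\<dots> = 0"
      proof (intro sum.neutral ballI)
        fix k assume "k \<in> {- int N..n}"
        then show "disc_moment (polar_term g k) j l = 0"
          using jl int[of k] by (intro disc_moment_homogeneous[of _ k]) (auto simp: polar_term_rotation)
      qed
      finally have "disc_moment g j l = disc_moment (\<lambda>z. g z - ?s z) j l"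
        using g s by (simp add: disc_moment_diff)
      then show ?thesis using disc_moment_norm_le[of "\<lambda>z. g z - ?s z" j l] g s by simp
    qed
    then have "cmod (disc_moment g j l) \<le> 0"
      by (intro LIMSEQ_le_const[OF lim]) auto
    then show ?thesis by simp
  qed
  then show thesis by (rule that)
qed

text \<open>
  The power series need not converge in the mean on the whole disc. The dilated function
  \<open>w \<mapsto> F (\<rho> w)\<close> with \<open>\<rho> < 1\<close> has a uniformly convergent series, and boundedness of \<open>F\<close> allows the limit
  \<open>\<rho> \<rightarrow> 1\<close> by dominated convergence.
\<close>

lemma disc_moment_power_series:
  assumes F: "\<And>w. w \<in> unit_disc \<Longrightarrow> (\<lambda>i. c i * w ^ i) sums F w"
    and B: "\<And>w. w \<in> unit_disc \<Longrightarrow> cmod (F w) \<le> B"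
  shows "disc_moment F j l = (if j \<le> l then c (l - j) / (of_nat l + 1) else 0)"
proof -
  define \<rho> where "\<rho> n = real n / (real n + 1)" for n
  have \<rho>: "0 \<le> \<rho> n" "\<rho> n < 1" for n by (auto simp: \<rho>_def)
  have \<rho>lim: "\<rho> \<longlonglongrightarrow> 1"
    unfolding \<rho>_def using LIMSEQ_n_over_Suc_n by (simp add: add.commute)
  have in_disc: "of_real (\<rho> n) * w \<in> unit_disc" if "w \<in> unit_disc" for n w
  proof -
    have "\<rho> n * cmod w \<le> 1 * cmod w" using \<rho>[of n] by (intro mult_right_mono) auto
    then show ?thesis using that \<rho>[of n] by (simp add: norm_mult)
  qed
  have "F holomorphic_on unit_disc"
    using F by (intro power_series_holomorphic[of 0 1 c]) auto
  then have Fcont: "continuous_on unit_disc F" by (rule holomorphic_on_imp_continuous_on)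
  have F\<rho>cont: "continuous_on unit_disc (\<lambda>w. F (of_real (\<rho> n) * w))" for n
    by (intro continuous_on_compose2[OF Fcont] continuous_intros) (use in_disc in auto)
  have abs_summable: "summable (\<lambda>i. cmod (c i) * \<rho> n ^ i)" for n
  proof -
    \<comment> \<open>A radius strictly between \<open>\<rho> n\<close> and \<open>1\<close>, where the power series still converges.\<close>
    define r where "r = (\<rho> n + 1) / 2"
    have "summable (\<lambda>i. c i * of_real r ^ i)"
      using F[of "of_real r"] \<rho>[of n] by (auto simp: r_def sums_iff)
    then have "summable (\<lambda>i. norm (c i * of_real (\<rho> n) ^ i))"
      using \<rho>[of n] by (intro powser_insidea[of c "of_real r"]) (auto simp: r_def)
    then show ?thesis using \<rho>[of n] by (simp add: norm_mult norm_power)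
  qed
  have dilated: "disc_moment (\<lambda>w. F (of_real (\<rho> n) * w)) j l
      = (if j \<le> l then c (l - j) * of_real (\<rho> n) ^ (l - j) / (of_nat l + 1) else 0)" for n
  proof -
    let ?M = "\<Sum>i. cmod (c i) * \<rho> n ^ i"
    let ?s = "\<lambda>N w. \<Sum>i<N. (c i * of_real (\<rho> n) ^ i) * (1 * (w ^ i * cnj w ^ 0))"
    have one: "integrable disc_area (\<lambda>w. 1 :: complex)"
      by (simp add: finite_measure.integrable_const finite_measure_disc_area)
    have monomial: "integrable disc_area (\<lambda>w. 1 * (w ^ i * cnj w ^ 0))" for i
      using disc_moment_integrable[OF one, of i 0] by (simp add: mult.assoc)
    have "(\<lambda>N. LINT w|disc_area. ?s N w * w ^ j * cnj w ^ l) \<longlonglongrightarrow> (LINT w|disc_area. F (of_real (\<rho> n) * w) * w ^ j * cnj w ^ l)"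
    proof (rule integral_dominated_convergence[where w = "\<lambda>_. ?M"])
      show "integrable disc_area (\<lambda>_. ?M)"
        by (simp add: finite_measure.integrable_const finite_measure_disc_area)
      show "(\<lambda>w. F (of_real (\<rho> n) * w) * w ^ j * cnj w ^ l) \<in> borel_measurable disc_area"
        by (intro disc_area_measurable_continuous continuous_intros F\<rho>cont)
      show "(\<lambda>w. ?s N w * w ^ j * cnj w ^ l) \<in> borel_measurable disc_area" for N
        by (intro disc_area_measurable_continuous continuous_intros)
      show "AE w in disc_area. (\<lambda>N. ?s N w * w ^ j * cnj w ^ l) \<longlonglongrightarrow> F (of_real (\<rho> n) * w) * w ^ j * cnj w ^ l"
      proof (rule AE_I2)
        fix w assume "w \<in> space disc_area"
        then have "(\<lambda>i. c i * (of_real (\<rho> n) * w) ^ i) sums F (of_real (\<rho> n) * w)"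
          by (intro F in_disc) (simp add: space_disc_area)
        then have "(\<lambda>N. ?s N w) \<longlonglongrightarrow> F (of_real (\<rho> n) * w)"
          by (simp add: sums_def power_mult_distrib mult.assoc)
        then show "(\<lambda>N. ?s N w * w ^ j * cnj w ^ l) \<longlonglongrightarrow> F (of_real (\<rho> n) * w) * w ^ j * cnj w ^ l"
          by (intro tendsto_intros)
      qed
      show "AE w in disc_area. norm (?s N w * w ^ j * cnj w ^ l) \<le> ?M" for N
      proof (rule AE_I2)
        fix w assume "w \<in> space disc_area"
        then have w: "w \<in> unit_disc" by (simp add: space_disc_area)
        have "norm (?s N w * w ^ j * cnj w ^ l) \<le> norm (?s N w)"
          using disc_monomial_bound[OF w, of j l] by (simp add: norm_mult mult.assoc mult_left_le)
        also have "\<dots> \<le> (\<Sum>i<N. cmod (c i) * \<rho> n ^ i)"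
        proof (rule sum_norm_le)
          fix i
          have "cmod (c i) * \<rho> n ^ i * cmod w ^ i \<le> cmod (c i) * \<rho> n ^ i * 1"
            using w \<rho>[of n] by (intro mult_left_mono power_le_one) auto
          then show "norm ((c i * of_real (\<rho> n) ^ i) * (1 * (w ^ i * cnj w ^ 0))) \<le> cmod (c i) * \<rho> n ^ i"
            using \<rho>[of n] by (simp add: norm_mult norm_power)
        qed
        also have "\<dots> \<le> ?M"
          using \<rho>[of n] by (intro sum_le_suminf abs_summable) auto
        finally show "norm (?s N w * w ^ j * cnj w ^ l) \<le> ?M" .
      qed
    qed
    then have lim: "(\<lambda>N. disc_moment (?s N) j l) \<longlonglongrightarrow> disc_moment (\<lambda>w. F (of_real (\<rho> n) * w)) j l"
      by (simp only: disc_moment_def)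
    have s: "disc_moment (?s N) j l = (if j \<le> l then c (l - j) * of_real (\<rho> n) ^ (l - j) / (of_nat l + 1) else 0)"
      if "N > l" for N
    proof -
      have "disc_moment (?s N) j l = (\<Sum>i<N. (c i * of_real (\<rho> n) ^ i) * disc_moment (\<lambda>w. 1 * (w ^ i * cnj w ^ 0)) j l)"
        unfolding disc_moment_cmult[symmetric] by (rule disc_moment_sum) (rule integrable_mult_right, rule monomial)
      also have "\<dots> = (\<Sum>i<N. if i = l - j then (if j \<le> l then c i * of_real (\<rho> n) ^ i / (of_nat l + 1) else 0) else 0)"
        unfolding disc_moment_times_monomial disc_moment_one by (intro sum.cong refl) auto
      also have "\<dots> = (if j \<le> l then c (l - j) * of_real (\<rho> n) ^ (l - j) / (of_nat l + 1) else 0)"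
        using that by (subst sum.delta) auto
      finally show ?thesis .
    qed
    show ?thesis
      by (rule LIMSEQ_unique[OF lim], rule tendsto_eventually, rule eventually_mono[OF eventually_gt_at_top[of l]]) (rule s)
  qed
  have "(\<lambda>n. LINT w|disc_area. F (of_real (\<rho> n) * w) * w ^ j * cnj w ^ l) \<longlonglongrightarrow> (LINT w|disc_area. F w * w ^ j * cnj w ^ l)"
  proof (rule integral_dominated_convergence[where w = "\<lambda>_. B"])
    show "integrable disc_area (\<lambda>_. B)"
      by (simp add: finite_measure.integrable_const finite_measure_disc_area)
    show "(\<lambda>w. F w * w ^ j * cnj w ^ l) \<in> borel_measurable disc_area"
      by (intro disc_area_measurable_continuous continuous_intros Fcont)
    show "(\<lambda>w. F (of_real (\<rho> n) * w) * w ^ j * cnj w ^ l) \<in> borel_measurable disc_area" for n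
      by (intro disc_area_measurable_continuous continuous_intros F\<rho>cont)
    show "AE w in disc_area. (\<lambda>n. F (of_real (\<rho> n) * w) * w ^ j * cnj w ^ l) \<longlonglongrightarrow> F w * w ^ j * cnj w ^ l"
    proof (rule AE_I2)
      fix w assume "w \<in> space disc_area"
      then have w: "w \<in> unit_disc" by (simp add: space_disc_area)
      have cont: "isCont F w" using Fcont w open_ball by (metis continuous_on_eq_continuous_at)
      have "(\<lambda>n. of_real (\<rho> n) * w) \<longlonglongrightarrow> of_real 1 * w"
        by (intro tendsto_mult tendsto_of_real \<rho>lim tendsto_const)
      then have "(\<lambda>n. F (of_real (\<rho> n) * w)) \<longlonglongrightarrow> F w"
        by (intro isCont_tendsto_compose[OF cont]) simp
      then show "(\<lambda>n. F (of_real (\<rho> n) * w) * w ^ j * cnj w ^ l) \<longlonglongrightarrow> F w * w ^ j * cnj w ^ l"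
        by (intro tendsto_intros)
    qed
    show "AE w in disc_area. norm (F (of_real (\<rho> n) * w) * w ^ j * cnj w ^ l) \<le> B" for n
    proof (rule AE_I2)
      fix w assume "w \<in> space disc_area"
      then have w: "w \<in> unit_disc" by (simp add: space_disc_area)
      have "norm (F (of_real (\<rho> n) * w) * w ^ j * cnj w ^ l) \<le> norm (F (of_real (\<rho> n) * w))"
        using disc_monomial_bound[OF w, of j l] by (simp add: norm_mult mult.assoc mult_left_le)
      also have "\<dots> \<le> B" by (rule B[OF in_disc[OF w]])
      finally show "norm (F (of_real (\<rho> n) * w) * w ^ j * cnj w ^ l) \<le> B" .
    qed
  qed
  then have lim: "(\<lambda>n. disc_moment (\<lambda>w. F (of_real (\<rho> n) * w)) j l) \<longlonglongrightarrow> disc_moment F j l"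
    by (simp only: disc_moment_def)
  have "(\<lambda>n. disc_moment (\<lambda>w. F (of_real (\<rho> n) * w)) j l) \<longlonglongrightarrow> (if j \<le> l then c (l - j) * of_real 1 ^ (l - j) / (of_nat l + 1) else 0)"
  proof (cases "j \<le> l")
    case True
    show ?thesis
      unfolding dilated if_P[OF True] by (intro tendsto_divide tendsto_mult tendsto_power tendsto_of_real \<rho>lim tendsto_const)
        (metis of_nat_Suc of_nat_neq_0 add.commute)
  qed (simp add: dilated)
  then show ?thesis using LIMSEQ_unique[OF lim] by simp
qed

lemma disc_moment_cnj: "disc_moment (\<lambda>w. cnj (u w)) j l = cnj (disc_moment u l j)"
proof -
  have "cnj (disc_moment u l j) = (LINT w|disc_area. cnj (u w * w ^ l * cnj w ^ j))"
    unfolding disc_moment_def by (rule Bochner_Integration.integral_cnj[symmetric])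
  then show ?thesis by (simp add: disc_moment_def mult_ac)
qed

section \<open>Moments determine an integrable function\<close>

definition moment_free :: "(complex \<Rightarrow> complex) \<Rightarrow> bool"
  where "moment_free u \<longleftrightarrow> integrable disc_area u \<and> (\<forall>j l. disc_moment u j l = 0)"

text \<open>
  Vanishing of all moments is stable under multiplication by \<open>w\<close> and \<open>cnj w\<close>, hence by real linear
  functions, and so by all real polynomials in the coordinates.
\<close>

lemma moment_free_times_polynomial:
  assumes "real_polynomial_function p" "moment_free u"
  shows "moment_free (\<lambda>w. u w * of_real (p w))"
  using assms
proof (induction arbitrary: u rule: real_polynomial_function.induct)
  case (linear p)
  interpret p: bounded_linear p by fact
  \<comment> \<open>Real linear functions are combinations of \<open>w\<close> and \<open>cnj w\<close>.\<close>
  define \<alpha> where "\<alpha> = (complex_of_real (p 1) - \<i> * p \<i>) / 2"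
  define \<beta> where "\<beta> = (complex_of_real (p 1) + \<i> * p \<i>) / 2"
  have pw: "p w = Re w * p 1 + Im w * p \<i>" for w
  proof -
    have "w = Re w *\<^sub>R 1 + Im w *\<^sub>R \<i>" by (simp add: complex_eq_iff)
    then have "p w = p (Re w *\<^sub>R 1 + Im w *\<^sub>R \<i>)" by simp
    then show ?thesis by (simp add: p.add p.scaleR)
  qed
  then have p: "complex_of_real (p w) = \<alpha> * w + \<beta> * cnj w" for w
  proof -
    have "\<alpha> * w + \<beta> * cnj w = (p 1 * (w + cnj w) - \<i> * p \<i> * (w - cnj w)) / 2"
      by (simp add: \<alpha>_def \<beta>_def algebra_simps add_divide_distrib diff_divide_distrib)
    then show ?thesis
      by (subst pw) (simp only: complex_add_cnj complex_diff_cnj, simp add: algebra_simps)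
  qed
  let ?v = "\<lambda>i k w. u w * (w ^ i * cnj w ^ k)"
  have v: "integrable disc_area (?v i k)" for i k
    using disc_moment_integrable[of u i k] linear by (simp add: moment_free_def mult.assoc)
  have "(\<lambda>w. u w * of_real (p w)) = (\<lambda>w. \<alpha> * ?v 1 0 w + \<beta> * ?v 0 1 w)"
    by (simp add: p algebra_simps)
  moreover have "moment_free (\<lambda>w. \<alpha> * ?v 1 0 w + \<beta> * ?v 0 1 w)"
    unfolding moment_free_def
  proof (intro conjI allI)
    show "integrable disc_area (\<lambda>w. \<alpha> * ?v 1 0 w + \<beta> * ?v 0 1 w)"
      by (intro Bochner_Integration.integrable_add integrable_mult_right v)
    fix j l
    have "disc_moment (\<lambda>w. \<alpha> * ?v 1 0 w + \<beta> * ?v 0 1 w) j l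
        = \<alpha> * disc_moment u (j + 1) (l + 0) + \<beta> * disc_moment u (j + 0) (l + 1)"
      unfolding disc_moment_times_monomial[symmetric] disc_moment_cmult[symmetric]
      by (intro disc_moment_add integrable_mult_right v)
    then show "disc_moment (\<lambda>w. \<alpha> * ?v 1 0 w + \<beta> * ?v 0 1 w) j l = 0"
      using linear by (simp add: moment_free_def)
  qed
  ultimately show ?case by (simp only:)
next
  case (const c)
  then show ?case using disc_moment_cmult[of "of_real c" u] by (simp add: moment_free_def mult.commute)
next
  case (add p q)
  have "(\<lambda>w. u w * of_real (p w + q w)) = (\<lambda>w. u w * of_real (p w) + u w * of_real (q w))"
    by (simp add: algebra_simps)
  then show ?case using add by (simp add: moment_free_def disc_moment_add)
next
  case (mult p q)
  have "(\<lambda>w. u w * of_real (p w * q w)) = (\<lambda>w. u w * of_real (p w) * of_real (q w))"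
    by (simp add: algebra_simps)
  then show ?case using mult by simp
qed

lemma moment_free_times_continuous_real:
  assumes u: "moment_free u" and \<phi>: "continuous_on (cball 0 1) \<phi>"
  shows "(LINT w|disc_area. u w * of_real (\<phi> w)) = 0"
proof -
  have uint: "integrable disc_area u" using u by (simp add: moment_free_def)
  have cint: "integrable disc_area (\<lambda>w. u w * of_real (\<psi> w))" if "continuous_on (cball 0 1) \<psi>" for \<psi>
    by (intro continuous_closed_disc_mult_integrable uint continuous_on_of_real that)
  have "cmod (LINT w|disc_area. u w * of_real (\<phi> w)) \<le> e * (LINT w|disc_area. cmod (u w))" if "e > 0" for e
  proof -
    obtain p where p: "real_polynomial_function p" "\<And>w. w \<in> cball 0 1 \<Longrightarrow> \<bar>\<phi> w - p w\<bar> < e"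
      using Stone_Weierstrass_real_polynomial_function[OF compact_cball \<phi> \<open>e > 0\<close>] by metis
    have pc: "continuous_on (cball 0 1) p"
      using p(1) by (simp add: continuous_on_polymonial_function real_polynomial_function_eq)
    have "disc_moment (\<lambda>w. u w * of_real (p w)) 0 0 = 0"
      using moment_free_times_polynomial[OF p(1) u] by (simp add: moment_free_def)
    then have "(LINT w|disc_area. u w * of_real (\<phi> w)) = (LINT w|disc_area. u w * of_real (\<phi> w - p w))"
      using cint[OF \<phi>] cint[OF pc] by (simp add: disc_moment_def right_diff_distrib)
    also have "cmod \<dots> \<le> (LINT w|disc_area. cmod (u w * of_real (\<phi> w - p w)))"
      by (rule integral_norm_bound)
    also have "\<dots> \<le> (LINT w|disc_area. e * cmod (u w))"
    proof (rule integral_mono)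
      show "integrable disc_area (\<lambda>w. cmod (u w * of_real (\<phi> w - p w)))"
        by (intro integrable_norm cint continuous_intros \<phi> pc)
      fix w assume "w \<in> space disc_area"
      then have "\<bar>\<phi> w - p w\<bar> \<le> e" using p(2)[of w] by (simp add: space_disc_area)
      then show "cmod (u w * of_real (\<phi> w - p w)) \<le> e * cmod (u w)"
        by (simp only: norm_mult norm_of_real mult.commute[of e]) (intro mult_left_mono, auto)
    qed (use uint in simp)
    finally show ?thesis by simp
  qed
  then have "cmod (LINT w|disc_area. u w * of_real (\<phi> w)) \<le> 0 + e" if "e > 0" for e
  proof -
    assume *: "\<And>e. e > 0 \<Longrightarrow> cmod (LINT w|disc_area. u w * of_real (\<phi> w)) \<le> e * (LINT w|disc_area. cmod (u w))"
    define A where "A = (LINT w|disc_area. cmod (u w))"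
    have "A \<ge> 0" unfolding A_def by simp
    then have "e / (A + 1) > 0" "e / (A + 1) * A \<le> e"
      using that by (simp_all add: divide_le_eq mult_left_mono)
    then show ?thesis using *[of "e / (A + 1)"] unfolding A_def by linarith
  qed
  then have "cmod (LINT w|disc_area. u w * of_real (\<phi> w)) \<le> 0"
    by (rule field_le_epsilon)
  then show ?thesis by simp
qed

text \<open>
  The sign of \<open>u\<close> is a bounded limit of continuous functions almost everywhere, and all continuous
  functions integrate to zero against \<open>u\<close> by the Stone-Weierstrass theorem. Hence so does the sign of
  \<open>u\<close>, which gives the norm of \<open>u\<close>.
\<close>

lemma moment_free_AE_zero:
  assumes "moment_free u"
  shows "AE w in disc_area. u w = 0"
proof -
  have uint: "integrable disc_area u" using assms by (simp add: moment_free_def)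
  let ?\<sigma> = "\<lambda>w. cnj (sgn (u w))"
  have "u \<in> borel_measurable (lebesgue_on unit_disc)"
    using borel_measurable_integrable[OF uint] by (simp add: disc_area_def)
  then have "?\<sigma> \<in> borel_measurable (lebesgue_on unit_disc)"
    unfolding sgn_div_norm
    by (intro measurable_compose[OF _ borel_measurable_continuous_onI[OF continuous_on_cnj[OF continuous_on_id]]])
      measurable
  then have "?\<sigma> measurable_on unit_disc"
    by (subst measurable_on_iff_borel_measurable) auto
  then obtain N G where N: "negligible N" and G: "\<And>n. continuous_on UNIV (G n)"
    and lim: "\<And>w. w \<notin> N \<Longrightarrow> (\<lambda>n. G n w) \<longlonglongrightarrow> (if w \<in> unit_disc then ?\<sigma> w else 0)"
    unfolding measurable_on_def by blast
  \<comment> \<open>Radial truncation to the closed unit disc keeps continuity and does not affect the limit, which has modulus at most \<open>1\<close>.\<close>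
  define H where "H n w = G n w / of_real (max 1 (cmod (G n w)))" for n w
  have Hc: "continuous_on UNIV (H n)" for n
    unfolding H_def by (intro continuous_intros G) (auto simp: max_def)
  have H1: "cmod (H n w) \<le> 1" for n w
    by (simp add: H_def norm_divide divide_le_eq)
  have Hlim: "(\<lambda>n. H n w) \<longlonglongrightarrow> ?\<sigma> w" if "w \<in> unit_disc" "w \<notin> N" for w
  proof -
    have "(\<lambda>n. H n w) \<longlonglongrightarrow> ?\<sigma> w / of_real (max 1 (cmod (?\<sigma> w)))"
      unfolding H_def using lim[OF that(2)] that(1) by (intro tendsto_intros) auto
    moreover have "max 1 (cmod (?\<sigma> w)) = 1" by (simp add: norm_sgn)
    ultimately show ?thesis by simp
  qed
  have AEN: "AE w in disc_area. w \<notin> N"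
  proof -
    have "AE w in lebesgue. w \<notin> N"
      using N by (intro AE_not_in) (simp add: negligible_iff_null_sets)
    then have "AE w in lebesgue_on unit_disc. w \<notin> N"
      by (subst AE_restrict_space_iff) auto
    then show ?thesis unfolding disc_area_def by (subst AE_density) auto
  qed
  have zero: "(LINT w|disc_area. u w * H n w) = 0" for n
  proof -
    have "u w * H n w = u w * of_real (Re (H n w)) + \<i> * (u w * of_real (Im (H n w)))" for w
      by (subst complex_eq[of "H n w"]) (simp add: algebra_simps)
    moreover have ci: "continuous_on (cball 0 1) (\<lambda>w. Re (H n w))" "continuous_on (cball 0 1) (\<lambda>w. Im (H n w))"
      by (intro continuous_intros continuous_on_subset[OF Hc], simp)+
    moreover have "integrable disc_area (\<lambda>w. u w * of_real (Re (H n w)))" "integrable disc_area (\<lambda>w. u w * of_real (Im (H n w)))"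
      using H1[of n] abs_Re_le_cmod abs_Im_le_cmod
      by (intro disc_bounded_mult_integrable[OF uint, of _ 1] disc_area_measurable_continuous continuous_intros
          continuous_on_subset[OF Hc]; simp; meson order_trans)+
    ultimately show ?thesis
      using moment_free_times_continuous_real[OF assms ci(1)] moment_free_times_continuous_real[OF assms ci(2)]
      by simp
  qed
  have "(\<lambda>n. LINT w|disc_area. u w * H n w) \<longlonglongrightarrow> (LINT w|disc_area. complex_of_real (cmod (u w)))"
  proof (rule integral_dominated_convergence[where w = "\<lambda>w. cmod (u w)"])
    show "AE w in disc_area. (\<lambda>n. u w * H n w) \<longlonglongrightarrow> complex_of_real (cmod (u w))"
      using AEN AE_space
    proof eventually_elim
      case (elim w)
      then have "(\<lambda>n. u w * H n w) \<longlonglongrightarrow> u w * ?\<sigma> w"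
        by (intro tendsto_intros Hlim) (auto simp: space_disc_area)
      moreover have "u w * ?\<sigma> w = complex_of_real (cmod (u w))"
        by (cases "u w = 0") (simp_all add: sgn_div_norm scaleR_conv_of_real complex_norm_square[symmetric] power2_eq_square field_simps)
      ultimately show ?case by simp
    qed
    show "AE w in disc_area. norm (u w * H n w) \<le> cmod (u w)" for n
      using H1 by (intro AE_I2) (simp add: norm_mult mult_left_le)
    show "(\<lambda>w. u w * H n w) \<in> borel_measurable disc_area" for n
      by (intro borel_measurable_times[OF borel_measurable_integrable[OF uint]]
          disc_area_measurable_continuous continuous_on_subset[OF Hc]) auto
  qed (use uint in auto)
  then have "(LINT w|disc_area. complex_of_real (cmod (u w))) = 0"
    by (simp add: zero LIMSEQ_const_iff)
  then have "(LINT w|disc_area. cmod (u w)) = 0"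
    by simp
  then have "AE w in disc_area. cmod (u w) = 0"
    using uint by (subst (asm) integral_nonneg_eq_0_iff_AE) auto
  then show ?thesis by simp
qed

section \<open>Matrices of Toeplitz operators\<close>

text \<open>
  The coefficient of \<open>z\<^sup>l\<close> in the image of \<open>w\<^sup>j\<close> under the Toeplitz operator with symbol \<open>u\<close>.
\<close>

definition toeplitz_entry :: "(complex \<Rightarrow> complex) \<Rightarrow> nat \<Rightarrow> nat \<Rightarrow> complex"
  where "toeplitz_entry u j l = (of_nat l + 1) * disc_moment u j l"

lemma toeplitz_entry_eq_0_iff: "toeplitz_entry u j l = 0 \<longleftrightarrow> disc_moment u j l = 0"
  using of_nat_neq_0[of l, where 'a = complex] by (auto simp: toeplitz_entry_def add.commute)

lemma toeplitz_entry_diff_cmult: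
  assumes "integrable disc_area u" "integrable disc_area v"
  shows "toeplitz_entry (\<lambda>w. u w - c * v w) j l = toeplitz_entry u j l - c * toeplitz_entry v j l"
  using assms by (simp add: toeplitz_entry_def disc_moment_diff disc_moment_cmult algebra_simps)

lemma toeplitz_cong:
  "(\<And>w. w \<in> unit_disc \<Longrightarrow> h w = h' w) \<Longrightarrow> toeplitz u h z = toeplitz u h' z"
  unfolding toeplitz_def by (intro Bochner_Integration.integral_cong refl) (simp add: space_disc_area)

lemma toeplitz_integrand_integrable:
  assumes u: "integrable disc_area u" and z: "z \<in> unit_disc"
  shows "integrable disc_area (\<lambda>w. u w * w ^ j / (1 - cnj w * z)\<^sup>2)"
proof -
  have z1: "cmod z < 1" using z by simp
  have lower: "1 - cmod z \<le> cmod (1 - cnj w * z)" if "w \<in> unit_disc" for w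
  proof -
    have "cmod (cnj w * z) \<le> cmod z"
      using that by (simp add: norm_mult mult_left_le_one_le)
    then show ?thesis using norm_triangle_ineq2[of 1 "cnj w * z"] by simp
  qed
  have "integrable disc_area (\<lambda>w. u w * (w ^ j / (1 - cnj w * z)\<^sup>2))"
  proof (rule disc_bounded_mult_integrable[OF u, of _ "1 / (1 - cmod z)\<^sup>2"])
    have "1 - cnj w * z \<noteq> 0" if "w \<in> unit_disc" for w
      using lower[OF that] z1 by auto
    then show "(\<lambda>w. w ^ j / (1 - cnj w * z)\<^sup>2) \<in> borel_measurable disc_area"
      by (intro disc_area_measurable_continuous continuous_intros) auto
    fix w assume w: "w \<in> unit_disc"
    have "cmod (w ^ j) \<le> 1" using w by (simp add: norm_power power_le_one)
    moreover have "(1 - cmod z)\<^sup>2 \<le> (cmod (1 - cnj w * z))\<^sup>2"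
      using lower[OF w] z1 by (intro power_mono) auto
    moreover have "0 < (1 - cmod z)\<^sup>2" using z1 by simp
    ultimately show "cmod (w ^ j / (1 - cnj w * z)\<^sup>2) \<le> 1 / (1 - cmod z)\<^sup>2"
      by (simp only: norm_divide norm_power[of "1 - cnj w * z"]) (intro frac_le, auto)
  qed
  then show ?thesis by simp
qed

lemma toeplitz_monomial_sums:
  assumes u: "integrable disc_area u" and z: "z \<in> unit_disc"
  shows "(\<lambda>l. (of_nat l + 1) * disc_moment u j l * z ^ l) sums toeplitz u (\<lambda>w. w ^ j) z"
proof -
  have z1: "cmod z < 1" using z by simp
  let ?s = "\<lambda>n w. \<Sum>l<n. (of_nat l + 1) * z ^ l * (u w * w ^ j * cnj w ^ l)"
  have K: "(\<lambda>l. (of_nat l + 1) * (cnj w * z) ^ l) sums (1 / (1 - cnj w * z)\<^sup>2)" if "w \<in> unit_disc" for w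
  proof -
    have "cmod (cnj w * z) < 1"
      using that z1 by (simp add: norm_mult) (metis mult_left_le_one_le norm_ge_zero order_le_less_trans less_imp_le mult.commute)
    from geometric_deriv_sums[OF this] show ?thesis by (simp add: add.commute)
  qed
  have B: "summable (\<lambda>l. (real l + 1) * cmod z ^ l)"
    using geometric_deriv_sums[of "cmod z"] z1 by (auto simp: sums_iff add.commute)
  define M where "M = (\<Sum>l. (real l + 1) * cmod z ^ l)"
  have "(\<lambda>n. LINT w|disc_area. ?s n w) \<longlonglongrightarrow> (LINT w|disc_area. u w * w ^ j / (1 - cnj w * z)\<^sup>2)"
  proof (rule integral_dominated_convergence[where w = "\<lambda>w. M * cmod (u w)"])
    show "integrable disc_area (\<lambda>w. M * cmod (u w))" using u by simp
    show "?s n \<in> borel_measurable disc_area" for n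
      using disc_moment_integrable[OF u] by (intro borel_measurable_integrable) auto
    have "(\<lambda>w. u w * (w ^ j / (1 - cnj w * z)\<^sup>2)) \<in> borel_measurable disc_area"
    proof (rule borel_measurable_times)
      show "u \<in> borel_measurable disc_area" using u by auto
      have "1 - cnj w * z \<noteq> 0" if "w \<in> unit_disc" for w
      proof
        assume "1 - cnj w * z = 0"
        then have "cmod w * cmod z = 1" by (metis complex_mod_cnj eq_iff_diff_eq_0 norm_mult norm_one)
        then show False using that z1
          by simp (metis less_imp_le mult_left_le_one_le norm_ge_zero not_less)
      qed
      then show "(\<lambda>w. w ^ j / (1 - cnj w * z)\<^sup>2) \<in> borel_measurable disc_area"
        by (intro disc_area_measurable_continuous continuous_intros) auto
    qed
    then show "(\<lambda>w. u w * w ^ j / (1 - cnj w * z)\<^sup>2) \<in> borel_measurable disc_area" by simp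
    show "AE w in disc_area. (\<lambda>n. ?s n w) \<longlonglongrightarrow> u w * w ^ j / (1 - cnj w * z)\<^sup>2"
    proof (rule AE_I2)
      fix w assume "w \<in> space disc_area"
      then have "w \<in> unit_disc" by (simp add: space_disc_area)
      from sums_mult[OF K[OF this], of "u w * w ^ j"]
      show "(\<lambda>n. ?s n w) \<longlonglongrightarrow> u w * w ^ j / (1 - cnj w * z)\<^sup>2"
        by (simp add: sums_def power_mult_distrib mult_ac)
    qed
    show "AE w in disc_area. norm (?s n w) \<le> M * cmod (u w)" for n
    proof (rule AE_I2)
      fix w assume "w \<in> space disc_area"
      then have w: "w \<in> unit_disc" by (simp add: space_disc_area)
      have "norm (?s n w) \<le> (\<Sum>l<n. (real l + 1) * cmod z ^ l * cmod (u w))"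
      proof (rule sum_norm_le)
        fix l
        have "cmod (u w * w ^ j * cnj w ^ l) \<le> cmod (u w)"
          using disc_monomial_bound[OF w, of j l] by (simp add: norm_mult mult.assoc mult_left_le)
        moreover have "cmod (of_nat l + 1 :: complex) = real l + 1"
          using norm_of_nat[of "Suc l", where 'a=complex] by (simp add: add.commute)
        ultimately show "norm ((of_nat l + 1) * z ^ l * (u w * w ^ j * cnj w ^ l)) \<le> (real l + 1) * cmod z ^ l * cmod (u w)"
          by (simp only: norm_mult[of "(of_nat l + 1) * z ^ l"] norm_mult[of "of_nat l + 1"] norm_power[of z])
            (intro mult_left_mono mult_nonneg_nonneg, auto)
      qed
      also have "\<dots> \<le> M * cmod (u w)"
        unfolding sum_distrib_right[symmetric] M_def
        by (intro mult_right_mono sum_le_suminf B) auto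
      finally show "norm (?s n w) \<le> M * cmod (u w)" .
    qed
  qed
  moreover have "(LINT w|disc_area. ?s n w) = (\<Sum>l<n. (of_nat l + 1) * disc_moment u j l * z ^ l)" for n
    using disc_moment_integrable[OF u]
    by (simp add: disc_moment_def) (simp add: mult_ac)
  ultimately show ?thesis by (simp add: sums_def toeplitz_def)
qed

lemma toeplitz_monomial_eq_poly:
  assumes u: "integrable disc_area u" and band: "\<And>l. l > N \<Longrightarrow> toeplitz_entry u j l = 0"
    and z: "z \<in> unit_disc"
  shows "toeplitz u (\<lambda>w. w ^ j) z = (\<Sum>l\<le>N. toeplitz_entry u j l * z ^ l)"
proof -
  have "(\<lambda>l. toeplitz_entry u j l * z ^ l) sums toeplitz u (\<lambda>w. w ^ j) z"
    using toeplitz_monomial_sums[OF u z] by (simp add: toeplitz_entry_def)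
  moreover have "(\<lambda>l. toeplitz_entry u j l * z ^ l) sums (\<Sum>l\<le>N. toeplitz_entry u j l * z ^ l)"
    by (rule sums_finite) (auto simp: band)
  ultimately show ?thesis by (rule sums_unique2)
qed

lemma toeplitz_sum_monomials:
  assumes u: "integrable disc_area u" and z: "z \<in> unit_disc"
  shows "toeplitz u (\<lambda>w. \<Sum>i\<le>M. a i * w ^ i) z = (\<Sum>i\<le>M. a i * toeplitz u (\<lambda>w. w ^ i) z)"
proof -
  have "toeplitz u (\<lambda>w. \<Sum>i\<le>M. a i * w ^ i) z
      = (LINT w|disc_area. (\<Sum>i\<le>M. a i * (u w * w ^ i / (1 - cnj w * z)\<^sup>2)))"
    unfolding toeplitz_def by (simp add: sum_distrib_left sum_divide_distrib mult_ac)
  also have "\<dots> = (\<Sum>i\<le>M. a i * toeplitz u (\<lambda>w. w ^ i) z)"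
    unfolding toeplitz_def
    by (subst Bochner_Integration.integral_sum)
      (simp_all only: integral_mult_right_zero integrable_mult_right toeplitz_integrand_integrable[OF u z])
  finally show ?thesis .
qed

text \<open>
  Truncation at \<open>L\<close> makes the product linear in both factors without any summability condition. The
  products of interest do not depend on \<open>L\<close> once \<open>L\<close> is large compared with \<open>j\<close>. Rows index arguments
  and columns index values, so the left factor is the operator applied first.
\<close>

definition mat_prod :: "nat \<Rightarrow> (nat \<Rightarrow> nat \<Rightarrow> complex) \<Rightarrow> (nat \<Rightarrow> nat \<Rightarrow> complex) \<Rightarrow> nat \<Rightarrow> nat \<Rightarrow> complex"
  where "mat_prod L A B j l = (\<Sum>i\<le>L. A j i * B i l)"

lemma power_sum_coeffs_unique:
  fixes a b :: "nat \<Rightarrow> complex"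
  assumes "\<And>z. z \<in> unit_disc \<Longrightarrow> (\<Sum>i\<le>N. a i * z ^ i) = (\<Sum>i\<le>N. b i * z ^ i)" and "l \<le> N"
  shows "a l = b l"
proof (rule ccontr)
  assume "a l \<noteq> b l"
  then have "finite {z. (\<Sum>i\<le>N. (a i - b i) * z ^ i) = 0}"
    using assms(2) by (subst polyfun_finite_roots) auto
  moreover have "unit_disc \<subseteq> {z. (\<Sum>i\<le>N. (a i - b i) * z ^ i) = 0}"
    using assms(1) by (auto simp: left_diff_distrib sum_subtractf)
  ultimately have "finite unit_disc" by (rule rev_finite_subset)
  moreover have "uncountable unit_disc" by (rule uncountable_ball) simp
  ultimately show False using uncountable_infinite by blast
qed

text \<open>
  Both operators map monomials to polynomials, so commutation on \<open>w\<^sup>j\<close> is an equality of two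
  polynomials on the disc, whose coefficients are the matrix products.
\<close>

lemma toeplitz_commute_entries:
  assumes f: "integrable disc_area f" and g: "integrable disc_area g"
    and bf: "\<And>j l. l > j + d \<Longrightarrow> toeplitz_entry f j l = 0"
    and bg: "\<And>j l. l > j + n \<Longrightarrow> toeplitz_entry g j l = 0"
    and comm: "\<And>j z. z \<in> unit_disc \<Longrightarrow>
      toeplitz g (toeplitz f (\<lambda>w. w ^ j)) z = toeplitz f (toeplitz g (\<lambda>w. w ^ j)) z"
    and L: "L \<ge> j + d + n"
  shows "mat_prod L (toeplitz_entry f) (toeplitz_entry g) j l = mat_prod L (toeplitz_entry g) (toeplitz_entry f) j l"
proof -
  have *: "toeplitz v (toeplitz u (\<lambda>w. w ^ j)) z
      = (\<Sum>l\<le>N. mat_prod L (toeplitz_entry u) (toeplitz_entry v) j l * z ^ l)"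
    if u: "integrable disc_area u" and v: "integrable disc_area v"
      and bu: "\<And>l. l > L \<Longrightarrow> toeplitz_entry u j l = 0"
      and bv: "\<And>i l. i \<le> L \<Longrightarrow> l > N \<Longrightarrow> toeplitz_entry v i l = 0"
      and z: "z \<in> unit_disc" for u v z N
  proof -
    have "toeplitz v (toeplitz u (\<lambda>w. w ^ j)) z = toeplitz v (\<lambda>w. \<Sum>i\<le>L. toeplitz_entry u j i * w ^ i) z"
      by (rule toeplitz_cong) (rule toeplitz_monomial_eq_poly[OF u bu])
    also have "\<dots> = (\<Sum>i\<le>L. toeplitz_entry u j i * (\<Sum>l\<le>N. toeplitz_entry v i l * z ^ l))"
      unfolding toeplitz_sum_monomials[OF v z]
      by (intro sum.cong refl) (simp add: toeplitz_monomial_eq_poly[OF v bv z])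
    also have "\<dots> = (\<Sum>l\<le>N. mat_prod L (toeplitz_entry u) (toeplitz_entry v) j l * z ^ l)"
      unfolding mat_prod_def sum_distrib_left sum_distrib_right
      by (subst sum.swap) (simp add: mult.assoc)
    finally show ?thesis .
  qed
  let ?N = "L + d + n + l"
  show ?thesis
  proof (rule power_sum_coeffs_unique[where N = ?N])
    fix z assume z: "z \<in> unit_disc"
    show "(\<Sum>l\<le>?N. mat_prod L (toeplitz_entry f) (toeplitz_entry g) j l * z ^ l)
      = (\<Sum>l\<le>?N. mat_prod L (toeplitz_entry g) (toeplitz_entry f) j l * z ^ l)"
      using comm[OF z, of j] *[OF f g _ _ z, of ?N] *[OF g f _ _ z, of ?N] bf bg L by simp
  qed simp
qed

lemma toeplitz_entry_poly:
  assumes "\<And>w. w \<in> unit_disc \<Longrightarrow> u w = poly p w"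
  shows "toeplitz_entry u j l = (if j \<le> l then coeff p (l - j) else 0)"
proof -
  have "continuous_on (cball 0 1) (poly p)" by (intro continuous_intros)
  then obtain B where B: "\<And>w. w \<in> unit_disc \<Longrightarrow> cmod (poly p w) \<le> B"
    using continuous_closed_disc_bounded by blast
  have "(\<lambda>i. coeff p i * w ^ i) sums poly p w" for w
    using sums_finite[of "{..degree p}" "\<lambda>i. coeff p i * w ^ i"] by (simp add: poly_altdef coeff_eq_0)
  then have "disc_moment u j l = (if j \<le> l then coeff p (l - j) / (of_nat l + 1) else 0)"
    using B assms by (intro disc_moment_power_series[of "coeff p" u B]) auto
  moreover have "of_nat l + 1 \<noteq> (0::complex)" using of_nat_neq_0[of l, where 'a=complex] by (simp add: add.commute)
  ultimately show ?thesis by (simp add: toeplitz_entry_def)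
qed

text \<open>
  The values \<open>q i\<close> are the conjugated Taylor coefficients of \<open>z\<^sup>m f\<^sub>2(z)\<close>. This function is bounded
  because \<open>f\<close> and the polynomial are, so its moments can be read off from its Taylor series.
\<close>

lemma toeplitz_entry_harmonic:
  fixes f f2 :: "complex \<Rightarrow> complex" and p :: "complex poly" and m :: nat
  assumes bdd: "bounded (f ` unit_disc)" and f2: "f2 holomorphic_on unit_disc" "f2 0 \<noteq> 0"
    and m: "m > 0"
    and f: "\<And>z. z \<in> unit_disc \<Longrightarrow> f z = poly p z + cnj z ^ m * cnj (f2 z)"
  obtains q where "q m \<noteq> 0" "\<And>i. i < m \<Longrightarrow> q i = 0"
    "\<And>j l. toeplitz_entry f j l
      = (if j \<le> l then coeff p (l - j) else q (j - l) * (of_nat l + 1) / (of_nat j + 1))"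
proof -
  define b where "b i = (deriv ^^ i) f2 0 / fact i" for i
  define c where "c i = (if i < m then 0 else b (i - m))" for i
  let ?F = "\<lambda>w. w ^ m * f2 w"
  have F: "(\<lambda>i. c i * w ^ i) sums ?F w" if "w \<in> unit_disc" for w
  proof -
    have "(\<lambda>i. b i * w ^ i) sums f2 w"
      using holomorphic_power_series[OF f2(1) that] by (simp add: b_def)
    from sums_mult[OF this, of "w ^ m"] have "(\<lambda>i. c (i + m) * w ^ (i + m)) sums ?F w"
      by (simp add: c_def power_add mult_ac)
    then show ?thesis
      by (subst (asm) sums_zero_iff_shift) (auto simp: c_def)
  qed
  obtain Bf where Bf: "\<And>w. w \<in> unit_disc \<Longrightarrow> cmod (f w) \<le> Bf"
    using bdd by (metis bounded_iff imageI)
  have "continuous_on (cball 0 1) (poly p)" by (intro continuous_intros)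
  then obtain Bp where Bp: "\<And>w. w \<in> unit_disc \<Longrightarrow> cmod (poly p w) \<le> Bp"
    using continuous_closed_disc_bounded by blast
  have FB: "cmod (?F w) \<le> Bf + Bp" if "w \<in> unit_disc" for w
  proof -
    have "?F w = cnj (f w - poly p w)" using f[OF that] by simp
    then have "cmod (?F w) = cmod (f w - poly p w)" by (simp only: complex_mod_cnj)
    also have "\<dots> \<le> Bf + Bp"
      using Bf[OF that] Bp[OF that] by (intro norm_triangle_le_diff add_mono) auto
    finally show ?thesis .
  qed
  have Fc: "continuous_on unit_disc ?F"
    using holomorphic_on_imp_continuous_on[OF f2(1)] by (intro continuous_intros)
  have "disc_moment f j l = disc_moment (\<lambda>w. poly p w + cnj (?F w)) j l" for j l
    unfolding disc_moment_def using f by (intro Bochner_Integration.integral_cong refl) (simp add: space_disc_area)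
  also have "disc_moment (\<lambda>w. poly p w + cnj (?F w)) j l = disc_moment (poly p) j l + cnj (disc_moment ?F l j)" for j l
  proof (subst disc_moment_cnj[symmetric], rule disc_moment_add)
    show "integrable disc_area (poly p)"
      by (intro continuous_closed_disc_integrable continuous_intros)
    show "integrable disc_area (\<lambda>w. cnj (?F w))"
      using FB by (intro disc_bounded_integrable[of _ "Bf + Bp"] disc_area_measurable_continuous continuous_on_cnj Fc)
        (simp only: complex_mod_cnj)
  qed
  finally have *: "toeplitz_entry f j l = toeplitz_entry (poly p) j l + (of_nat l + 1) * cnj (disc_moment ?F l j)" for j l
    by (simp add: toeplitz_entry_def distrib_left)
  have "c 0 = 0" using m by (simp add: c_def)
  have FM: "disc_moment ?F l j = (if l \<le> j then c (j - l) / (of_nat j + 1) else 0)" for j l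
    by (rule disc_moment_power_series[OF F FB])
  have "toeplitz_entry f j l
      = (if j \<le> l then coeff p (l - j) else cnj (c (j - l)) * (of_nat l + 1) / (of_nat j + 1))" for j l
    unfolding * FM toeplitz_entry_poly[OF refl]
    using \<open>c 0 = 0\<close> by auto
  then show thesis
    using f2(2) by (intro that[of "\<lambda>i. cnj (c i)"]) (auto simp: c_def b_def)
qed

section \<open>Moments along a diagonal\<close>

abbreviation norm_sq :: "complex \<Rightarrow> complex"
  where "norm_sq w \<equiv> of_real ((cmod w)\<^sup>2)"

lemma disc_moment_diagonal: "disc_moment h i i = (LINT w|disc_area. h w * norm_sq w ^ i)"
proof -
  have "w ^ i * cnj w ^ i = norm_sq w ^ i" for w
    by (simp flip: power_mult_distrib complex_norm_square)
  then show ?thesis by (simp add: disc_moment_def mult.assoc)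
qed

lemma diagonal_integrable:
  fixes h \<phi> :: "complex \<Rightarrow> complex"
  assumes "integrable disc_area h" and "continuous_on UNIV \<phi>"
  shows "integrable disc_area (\<lambda>w. h w * \<phi> (norm_sq w))"
  by (intro continuous_closed_disc_mult_integrable assms(1) continuous_on_compose2[OF assms(2)] continuous_intros) auto

text \<open>
  Test functions of the squared modulus only have to converge on the open interval, since the origin
  is a null set.
\<close>

lemma diagonal_dominated_convergence:
  fixes h :: "complex \<Rightarrow> complex" and \<phi> :: "nat \<Rightarrow> real \<Rightarrow> real"
  assumes h: "integrable disc_area h" and cont: "\<And>n. continuous_on UNIV (\<phi> n)"
    and lim: "\<And>x. 0 < x \<Longrightarrow> x < 1 \<Longrightarrow> (\<lambda>n. \<phi> n x) \<longlonglongrightarrow> 0"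
    and bound: "\<And>n x. 0 \<le> x \<Longrightarrow> x < 1 \<Longrightarrow> \<bar>\<phi> n x\<bar> \<le> 1"
  shows "(\<lambda>n. LINT w|disc_area. h w * of_real (\<phi> n ((cmod w)\<^sup>2))) \<longlonglongrightarrow> 0"
proof -
  have sq: "(cmod w)\<^sup>2 < 1" if "w \<in> space disc_area" for w
    using that by (simp add: space_disc_area power_less_one_iff abs_square_less_1)
  have "(\<lambda>n. LINT w|disc_area. h w * of_real (\<phi> n ((cmod w)\<^sup>2))) \<longlonglongrightarrow> (LINT w|disc_area. 0)"
  proof (rule integral_dominated_convergence[where w = "\<lambda>w. cmod (h w)"])
    show "(\<lambda>w. h w * of_real (\<phi> n ((cmod w)\<^sup>2))) \<in> borel_measurable disc_area" for n
      by (intro borel_measurable_times[OF borel_measurable_integrable[OF h]]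
          disc_area_measurable_continuous continuous_intros continuous_on_compose2[OF cont]) auto
    show "AE w in disc_area. (\<lambda>n. h w * of_real (\<phi> n ((cmod w)\<^sup>2))) \<longlonglongrightarrow> 0"
      using AE_disc_nonzero AE_space
    proof eventually_elim
      case (elim w)
      then have "(\<lambda>n. h w * of_real (\<phi> n ((cmod w)\<^sup>2))) \<longlonglongrightarrow> h w * of_real 0"
        by (intro tendsto_intros lim sq) auto
      then show ?case by simp
    qed
    show "AE w in disc_area. norm (h w * of_real (\<phi> n ((cmod w)\<^sup>2))) \<le> cmod (h w)" for n
      using bound sq by (intro AE_I2) (simp add: norm_mult mult_left_le)
  qed (use h in auto)
  then show ?thesis by simp
qed

lemma power_mult_one_minus_le:
  fixes x :: real
  assumes "0 \<le> x" "x \<le> 1"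
  shows "real n * x ^ n * (1 - x) \<le> 1"
proof -
  have "real n * x ^ n = (\<Sum>t<n. x ^ n)" by simp
  also have "\<dots> \<le> (\<Sum>t<n. x ^ t)"
    using assms by (intro sum_mono power_decreasing) auto
  finally have "real n * x ^ n * (1 - x) \<le> (\<Sum>t<n. x ^ t) * (1 - x)"
    using assms by (intro mult_right_mono) auto
  also have "\<dots> = 1 - x ^ n"
    using one_diff_power_eq[of x n] by (simp add: mult.commute)
  finally show ?thesis using assms by (simp add: order_trans)
qed

text \<open>
  An entry with index \<open>i\<close> on a diagonal is \<open>(l + i + 1)\<close> times the integral of \<open>h x\<^sup>i\<close>, where \<open>x\<close> is the
  squared modulus. In the difference of neighbours the growing factor appears only in
  \<open>i x\<^sup>i (1 - x)\<close>, which is bounded by \<open>1\<close> and tends to \<open>0\<close> pointwise. This single fact replaces an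
  analytic continuation of the diagonal to complex indices.
\<close>

lemma toeplitz_entry_slowly_varying:
  assumes "integrable disc_area u"
  shows "(\<lambda>i. toeplitz_entry u (j + Suc i) (l + Suc i) - toeplitz_entry u (j + i) (l + i)) \<longlonglongrightarrow> 0"
proof -
  let ?h = "\<lambda>w. u w * w ^ j * cnj w ^ l"
  have h: "integrable disc_area ?h" using assms by (rule disc_moment_integrable)
  have hm: "disc_moment u (j + i) (l + i) = (LINT w|disc_area. ?h w * norm_sq w ^ i)" for i
  proof -
    have "disc_moment u (j + i) (l + i) = disc_moment ?h i i"
      by (simp add: disc_moment_def power_add mult_ac)
    then show ?thesis by (simp add: disc_moment_diagonal)
  qed
  have hint: "integrable disc_area (\<lambda>w. ?h w * norm_sq w ^ i)" for i
    by (intro diagonal_integrable h continuous_intros)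
  have l1: "(\<lambda>i. LINT w|disc_area. ?h w * of_real (((cmod w)\<^sup>2) ^ i)) \<longlonglongrightarrow> 0"
    by (intro diagonal_dominated_convergence[OF h, where \<phi>="\<lambda>i x. x ^ i"] continuous_intros LIMSEQ_power_zero)
      (auto simp: power_le_one)
  have l2: "(\<lambda>i. LINT w|disc_area. ?h w * of_real (real i * ((cmod w)\<^sup>2) ^ i * (1 - (cmod w)\<^sup>2))) \<longlonglongrightarrow> 0"
  proof (intro diagonal_dominated_convergence[OF h, where \<phi>="\<lambda>i x. real i * x ^ i * (1 - x)"] continuous_intros)
    show "(\<lambda>n. real n * x ^ n * (1 - x)) \<longlonglongrightarrow> 0" if "0 < x" "x < 1" for x
      using tendsto_mult_right[OF powser_times_n_limit_0[of x], of "1 - x"] that by simp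
    show "\<bar>real n * x ^ n * (1 - x)\<bar> \<le> 1" if "0 \<le> x" "x < 1" for n x
      using power_mult_one_minus_le[of x n] that by (simp add: abs_mult)
  qed
  have eq: "toeplitz_entry u (j + Suc i) (l + Suc i) - toeplitz_entry u (j + i) (l + i)
      = (of_nat l + 2) * (LINT w|disc_area. ?h w * of_real (((cmod w)\<^sup>2) ^ Suc i))
        - (LINT w|disc_area. ?h w * of_real (((cmod w)\<^sup>2) ^ i))
        - (LINT w|disc_area. ?h w * of_real (real i * ((cmod w)\<^sup>2) ^ i * (1 - (cmod w)\<^sup>2)))
        - of_nat l * (LINT w|disc_area. ?h w * of_real (((cmod w)\<^sup>2) ^ i))" for i
  proof -
    have *: "(LINT w|disc_area. ?h w * of_real (real i * ((cmod w)\<^sup>2) ^ i * (1 - (cmod w)\<^sup>2)))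
       = of_nat i * ((LINT w|disc_area. ?h w * norm_sq w ^ i) - (LINT w|disc_area. ?h w * norm_sq w ^ Suc i))"
    proof -
      have "?h w * of_real (real i * ((cmod w)\<^sup>2) ^ i * (1 - (cmod w)\<^sup>2))
          = of_nat i * (?h w * norm_sq w ^ i - ?h w * norm_sq w ^ Suc i)" for w
        by (simp add: algebra_simps)
      then show ?thesis using hint by (simp only: integral_mult_right_zero Bochner_Integration.integral_diff)
    qed
    show ?thesis
      unfolding * toeplitz_entry_def hm by (simp only: of_real_power) (simp add: algebra_simps)
  qed
  have "(\<lambda>i. toeplitz_entry u (j + Suc i) (l + Suc i) - toeplitz_entry u (j + i) (l + i))
     \<longlonglongrightarrow> (of_nat l + 2) * 0 - 0 - 0 - of_nat l * 0"
    unfolding eq by (intro tendsto_intros l1 l2 LIMSEQ_Suc[OF l1])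
  then show ?thesis by simp
qed

text \<open>
  A family of identities between moments, with coefficients that are affine in the exponent, is the
  same as one identity tested against all polynomials: a factor \<open>i\<close> becomes the operator \<open>x d/dx\<close>.
\<close>

lemma diagonal_polynomial_functional:
  fixes q :: "complex poly"
  assumes H0: "integrable disc_area H0" and H1: "integrable disc_area H1"
  shows "(LINT w|disc_area. H0 w * poly q (norm_sq w) + H1 w * (norm_sq w * poly (pderiv q) (norm_sq w)))
    = (\<Sum>i\<le>degree q. coeff q i * (disc_moment H0 i i + of_nat i * disc_moment H1 i i))"
proof -
  have q: "poly q x = (\<Sum>i\<le>degree q. coeff q i * x ^ i)" for x
    by (rule poly_altdef)
  have q': "x * poly (pderiv q) x = (\<Sum>i\<le>degree q. coeff q i * of_nat i * x ^ i)" for x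
  proof -
    have "pderiv (\<Sum>i\<in>A. f i) = (\<Sum>i\<in>A. pderiv (f i))" if "finite A" for A and f :: "nat \<Rightarrow> complex poly"
      using that by induction (simp_all add: pderiv_add)
    from this[of "{..degree q}" "\<lambda>i. monom (coeff q i) i"]
    have "pderiv q = (\<Sum>i\<le>degree q. pderiv (monom (coeff q i) i))"
      by (simp add: poly_as_sum_of_monoms)
    then have "x * poly (pderiv q) x = (\<Sum>i\<le>degree q. x * (of_nat i * coeff q i * x ^ (i - 1)))"
      by (simp add: poly_sum pderiv_monom poly_monom sum_distrib_left)
    also have "\<dots> = (\<Sum>i\<le>degree q. coeff q i * of_nat i * x ^ i)"
    proof (intro sum.cong refl)
      show "x * (of_nat i * coeff q i * x ^ (i - 1)) = coeff q i * of_nat i * x ^ i" for i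
        by (cases i) (simp_all del: of_nat_Suc)
    qed
    finally show ?thesis .
  qed
  have I: "integrable disc_area (\<lambda>w. H w * norm_sq w ^ i)" if "integrable disc_area H" for H i
    by (intro diagonal_integrable that continuous_intros)
  have "(LINT w|disc_area. H0 w * poly q (norm_sq w) + H1 w * (norm_sq w * poly (pderiv q) (norm_sq w)))
    = (LINT w|disc_area. (\<Sum>i\<le>degree q. coeff q i * (H0 w * norm_sq w ^ i + of_nat i * (H1 w * norm_sq w ^ i))))"
    unfolding q q' by (simp add: sum_distrib_left sum.distrib algebra_simps)
  also have "\<dots> = (\<Sum>i\<le>degree q. coeff q i * (disc_moment H0 i i + of_nat i * disc_moment H1 i i))"
    using I[OF H0] I[OF H1] by (simp del: of_real_power add: disc_moment_diagonal)
  finally show ?thesis .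
qed

text \<open>
  Test against \<open>(1 - x)\<^sup>N\<close>: only the constant coefficient of this polynomial sees a possibly nonzero
  term, so the functional has the same value for every \<open>N\<close>. It tends to \<open>0\<close>, because \<open>(1 - x)\<^sup>N\<close> and
  \<open>N x (1 - x)\<^bsup>N-1\<^esup>\<close> are bounded by \<open>1\<close> and tend to \<open>0\<close> for \<open>0 < x < 1\<close>.
\<close>

lemma diagonal_moment_extrapolation:
  assumes H0: "integrable disc_area H0" and H1: "integrable disc_area H1"
    and zero: "\<And>i. i \<ge> 1 \<Longrightarrow> disc_moment H0 i i + of_nat i * disc_moment H1 i i = 0"
  shows "disc_moment H0 0 0 = 0"
proof -
  let ?q = "\<lambda>N. [:1, -1:] ^ N :: complex poly"
  have c0: "coeff (?q N) 0 = 1" for N by (simp add: coeff_0_power)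
  have eq: "disc_moment H0 0 0 = (LINT w|disc_area. H0 w * of_real ((1 - (cmod w)\<^sup>2) ^ Suc N))
      - (LINT w|disc_area. H1 w * of_real (real (Suc N) * (cmod w)\<^sup>2 * (1 - (cmod w)\<^sup>2) ^ N))" for N
  proof -
    have "(LINT w|disc_area. H0 w * poly (?q (Suc N)) (norm_sq w) + H1 w * (norm_sq w * poly (pderiv (?q (Suc N))) (norm_sq w)))
      = (\<Sum>i\<le>degree (?q (Suc N)). if i = 0 then disc_moment H0 0 0 else 0)"
      unfolding diagonal_polynomial_functional[OF H0 H1]
      by (intro sum.cong refl) (use zero in \<open>auto simp: c0\<close>)
    also have "\<dots> = disc_moment H0 0 0" by simp
    also have "(LINT w|disc_area. H0 w * poly (?q (Suc N)) (norm_sq w) + H1 w * (norm_sq w * poly (pderiv (?q (Suc N))) (norm_sq w)))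
      = (LINT w|disc_area. H0 w * of_real ((1 - (cmod w)\<^sup>2) ^ Suc N) - H1 w * of_real (real (Suc N) * (cmod w)\<^sup>2 * (1 - (cmod w)\<^sup>2) ^ N))"
    proof (intro Bochner_Integration.integral_cong refl)
      fix w
      have "poly (pderiv (?q (Suc N))) x = - of_nat (Suc N) * (1 - x) ^ N" for x
        by (simp only: pderiv_power_Suc) (simp add: pderiv_pCons del: of_nat_Suc)
      moreover have "poly (?q (Suc N)) x = (1 - x) ^ Suc N" for x
        by (simp only: poly_power) simp
      ultimately show "H0 w * poly (?q (Suc N)) (norm_sq w) + H1 w * (norm_sq w * poly (pderiv (?q (Suc N))) (norm_sq w))
        = H0 w * of_real ((1 - (cmod w)\<^sup>2) ^ Suc N) - H1 w * of_real (real (Suc N) * (cmod w)\<^sup>2 * (1 - (cmod w)\<^sup>2) ^ N)"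
        by (simp only: of_real_mult of_real_power of_real_diff of_real_1 of_real_of_nat_eq) (simp only: mult_ac mult_minus_left mult_minus_right add_uminus_conv_diff)
    qed
    also have "\<dots> = (LINT w|disc_area. H0 w * of_real ((1 - (cmod w)\<^sup>2) ^ Suc N))
      - (LINT w|disc_area. H1 w * of_real (real (Suc N) * (cmod w)\<^sup>2 * (1 - (cmod w)\<^sup>2) ^ N))"
    proof (rule Bochner_Integration.integral_diff)
      show "integrable disc_area (\<lambda>w. H0 w * of_real ((1 - (cmod w)\<^sup>2) ^ Suc N))"
        using diagonal_integrable[OF H0, of "\<lambda>x. (1 - x) ^ Suc N"] by (simp add: continuous_intros)
      show "integrable disc_area (\<lambda>w. H1 w * of_real (real (Suc N) * (cmod w)\<^sup>2 * (1 - (cmod w)\<^sup>2) ^ N))"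
        using diagonal_integrable[OF H1, of "\<lambda>x. of_nat (Suc N) * x * (1 - x) ^ N"] by (simp add: continuous_intros)
    qed
    finally show ?thesis by simp
  qed
  have lim0: "(\<lambda>N. LINT w|disc_area. H0 w * of_real ((1 - (cmod w)\<^sup>2) ^ Suc N)) \<longlonglongrightarrow> 0"
  proof (intro diagonal_dominated_convergence[OF H0, where \<phi>="\<lambda>N x. (1 - x) ^ Suc N"] continuous_intros)
    show "(\<lambda>n. (1 - x) ^ Suc n) \<longlonglongrightarrow> 0" if "0 < x" "x < 1" for x :: real
      using that by (intro LIMSEQ_Suc LIMSEQ_power_zero) auto
    show "\<bar>(1 - x) ^ Suc n\<bar> \<le> 1" if "0 \<le> x" "x < 1" for n and x :: real
      using that power_le_one[of "1 - x" "Suc n"] by simp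
  qed
  have lim1: "(\<lambda>N. LINT w|disc_area. H1 w * of_real (real (Suc N) * (cmod w)\<^sup>2 * (1 - (cmod w)\<^sup>2) ^ N)) \<longlonglongrightarrow> 0"
  proof (intro diagonal_dominated_convergence[OF H1, where \<phi>="\<lambda>N x. real (Suc N) * x * (1 - x) ^ N"] continuous_intros)
    show "(\<lambda>n. real (Suc n) * x * (1 - x) ^ n) \<longlonglongrightarrow> 0" if "0 < x" "x < 1" for x :: real
    proof -
      have "(\<lambda>n. x * (real n * (1 - x) ^ n) + x * (1 - x) ^ n) \<longlonglongrightarrow> x * 0 + x * 0"
        using that by (intro tendsto_intros powser_times_n_limit_0 LIMSEQ_power_zero) auto
      then show ?thesis by (simp add: algebra_simps)
    qed
    show "\<bar>real (Suc n) * x * (1 - x) ^ n\<bar> \<le> 1" if "0 \<le> x" "x < 1" for n and x :: real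
    proof -
      have "real (Suc n) * x * (1 - x) ^ n = (\<Sum>t<Suc n. (1 - x) ^ n) * x" by simp
      also have "\<dots> \<le> (\<Sum>t<Suc n. (1 - x) ^ t) * x"
        using that by (intro mult_right_mono sum_mono power_decreasing) auto
      also have "\<dots> = 1 - (1 - x) ^ Suc n"
        using one_diff_power_eq[of "1 - x" "Suc n"] by (simp add: mult.commute)
      also have "\<dots> \<le> 1" using that by simp
      finally show ?thesis using that by (simp add: abs_mult del: of_nat_Suc)
    qed
  qed
  have "(\<lambda>N. disc_moment H0 0 0) \<longlonglongrightarrow> 0 - 0"
    using tendsto_diff[OF lim0 lim1] by (simp only: eq[symmetric])
  then show ?thesis by (simp add: LIMSEQ_const_iff)
qed

text \<open>
  As a function of \<open>j\<close> the right-hand side has a pole at \<open>-1\<close>, while for bounded \<open>g\<close> the left-hand side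
  would remain bounded there. To reach the index \<open>-1\<close> with polynomials, test against
  \<open>P = (1 - (1 - x)\<^sup>N) / x\<close>, an approximation of \<open>1 / x\<close>. On the right the integral of \<open>P\<close> is a partial
  sum of the harmonic series. On the left \<open>P + x P' = N (1 - x)\<^bsup>N-1\<^esup>\<close> has integral \<open>1\<close>, and the
  remaining terms are at most constant multiples of \<open>1\<close> and of the inverse of the modulus.
\<close>

lemma diagonal_moment_nonresonance:
  fixes d k n :: nat and C :: complex
  assumes g: "integrable disc_area g" and B: "AE w in disc_area. cmod (g w) \<le> B"
    and d: "d > 0" and n: "n > 0"
    and eq: "\<And>j. toeplitz_entry g (j + d) (j + d + k) - toeplitz_entry g j (j + k)
      = C * (1 / (of_nat j + 1) - 1 / (of_nat j + of_nat n + 1))"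
  shows "C = 0"
proof (rule ccontr)
  assume "C \<noteq> 0"
  let ?x = "\<lambda>w. (cmod w)\<^sup>2"
  have x: "0 \<le> ?x w" "?x w < 1" if "w \<in> space disc_area" for w
    using that by (auto simp: space_disc_area power_less_one_iff abs_square_less_1)
  have "0 \<le> B"
  proof -
    have "\<not> (AE w in disc_area. False)"
      by (simp add: AE_iff_measurable[OF _ refl] space_disc_area emeasure_disc_area_total trivial_limit_def[symmetric] ae_filter_eq_bot_iff)
    then obtain w where "cmod (g w) \<le> B" using B by (metis (mono_tags, lifting) eventually_mono)
    then show ?thesis using norm_ge_zero order_trans by blast
  qed
  let ?h = "\<lambda>w. g w * (w ^ 0 * cnj w ^ k)"
  have h: "integrable disc_area ?h"
    using disc_moment_integrable[OF g, of 0 k] by (simp add: mult.assoc)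
  define H1 where "H1 w = ?h w * norm_sq w ^ d - ?h w" for w
  define H0 where "H0 w = (of_nat (d + k) + 1) * (?h w * norm_sq w ^ d) - (of_nat k + 1) * ?h w
      - C * (1 * norm_sq w ^ 0 - 1 * norm_sq w ^ n)" for w
  have hi: "integrable disc_area (\<lambda>w. ?h w * norm_sq w ^ i)" for i
    by (intro diagonal_integrable h continuous_intros)
  have oi: "integrable disc_area (\<lambda>w. 1 * norm_sq w ^ i)" for i
    by (intro diagonal_integrable continuous_intros) (simp add: finite_measure.integrable_const finite_measure_disc_area)
  have H1: "integrable disc_area H1"
    unfolding H1_def by (intro Bochner_Integration.integrable_diff hi h)
  have i1: "integrable disc_area (\<lambda>w. (of_nat (d + k) + 1) * (?h w * norm_sq w ^ d))"
    by (rule integrable_mult_right, rule hi)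
  have i2: "integrable disc_area (\<lambda>w. (of_nat k + 1) * ?h w)"
    by (rule integrable_mult_right, rule h)
  have i3: "integrable disc_area (\<lambda>w. C * (1 * norm_sq w ^ 0 - 1 * norm_sq w ^ n))"
    by (rule integrable_mult_right, rule Bochner_Integration.integrable_diff; rule oi)
  note i12 = Bochner_Integration.integrable_diff[OF i1 i2]
  have H0: "integrable disc_area H0"
    unfolding H0_def by (rule Bochner_Integration.integrable_diff[OF i12 i3])
  have shift: "disc_moment (\<lambda>w. u w * norm_sq w ^ i) j j = disc_moment u (j + i) (j + i)" for u i j
    by (simp only: disc_moment_diagonal power_add mult.assoc mult.commute[of "_ ^ i"])
  have mh: "disc_moment ?h j j = disc_moment g j (j + k)" for j
    by (simp only: disc_moment_times_monomial add_0_right)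
  have zero: "disc_moment H0 j j + of_nat j * disc_moment H1 j j = 0" for j
  proof -
    have m1: "disc_moment H1 j j = disc_moment g (j + d) (j + d + k) - disc_moment g j (j + k)"
      unfolding H1_def disc_moment_diff[OF hi h] by (simp only: mh trans[OF shift mh])
    have m0: "disc_moment H0 j j = (of_nat (d + k) + 1) * disc_moment g (j + d) (j + d + k) - (of_nat k + 1) * disc_moment g j (j + k)
       - C * (1 / (of_nat j + 1) - 1 / (of_nat j + of_nat n + 1))"
    proof -
      have "disc_moment (\<lambda>w. ?h w * norm_sq w ^ d) j j = disc_moment g (j + d) (j + d + k)"
        by (rule trans[OF shift mh])
      moreover have "disc_moment (\<lambda>w. 1 * norm_sq w ^ i) j j = 1 / (of_nat j + of_nat i + 1)" for i
        by (rule trans[OF shift]) (simp add: disc_moment_one)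
      ultimately show ?thesis
        unfolding H0_def disc_moment_diff[OF i12 i3] disc_moment_diff[OF i1 i2]
          disc_moment_cmult disc_moment_diff[OF oi oi]
        by (simp only: mh) simp
    qed
    have "disc_moment H0 j j + of_nat j * disc_moment H1 j j
      = (toeplitz_entry g (j + d) (j + d + k) - toeplitz_entry g j (j + k))
        - C * (1 / (of_nat j + 1) - 1 / (of_nat j + of_nat n + 1))"
      unfolding m0 m1 toeplitz_entry_def by (simp add: algebra_simps)
    then show ?thesis unfolding eq by simp
  qed
  \<comment> \<open>\<open>P N\<close> is the polynomial \<open>(1 - (1 - x)\<^sup>N) / x\<close>; \<open>\<pi> N\<close> is its value at the squared modulus, and \<open>\<rho> N\<close> is the value of the derivative of \<open>x P (N + 1)\<close>.\<close>
  define P where "P N = (\<Sum>i<N. [:1, -1:] ^ i :: complex poly)" for N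
  have Px: "pCons 0 (P N) = 1 - [:1, -1:] ^ N" for N
  proof -
    have "pCons 0 (P N) = [:0, 1:] * P N" by simp
    also have "\<dots> = 1 - [:1, -1:] ^ N"
      using one_diff_power_eq[of "[:1, -1:] :: complex poly" N] by (simp add: P_def one_pCons)
    finally show ?thesis .
  qed
  define \<pi> where "\<pi> N w = (\<Sum>i<N. (1 - ?x w) ^ i)" for N w
  define \<rho> where "\<rho> N w = real (Suc N) * (1 - ?x w) ^ N" for N w
  have P\<pi>: "poly (P N) (norm_sq w) = of_real (\<pi> N w)" for N w
    by (simp add: P_def \<pi>_def poly_sum)
  have P\<rho>: "poly (P (Suc N)) (norm_sq w) + norm_sq w * poly (pderiv (P (Suc N))) (norm_sq w) = of_real (\<rho> N w)" for N w
  proof -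
    have "poly (pderiv (pCons 0 (P (Suc N)))) (norm_sq w) = of_real (\<rho> N w)"
      unfolding Px by (simp only: pderiv_diff pderiv_power_Suc) (simp add: pderiv_pCons \<rho>_def del: of_nat_Suc)
    then show ?thesis by (simp add: pderiv_pCons)
  qed
  have \<pi>x: "\<pi> N w * ?x w = 1 - (1 - ?x w) ^ N" for N w
    using one_diff_power_eq[of "1 - ?x w" N] by (simp add: \<pi>_def mult.commute)
  have cont: "continuous_on UNIV (\<lambda>w. \<pi> N w)" "continuous_on UNIV (\<lambda>w. \<rho> N w)" for N
    unfolding \<pi>_def \<rho>_def by (intro continuous_intros)+
  have pos: "0 \<le> \<pi> N w" "0 \<le> \<rho> N w" "\<pi> N w * ?x w \<le> 1" if "w \<in> space disc_area" for N w
  proof -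
    show "0 \<le> \<pi> N w" "0 \<le> \<rho> N w"
      using x[OF that] by (auto simp: \<pi>_def \<rho>_def sum_nonneg)
    show "\<pi> N w * ?x w \<le> 1"
      using x[OF that] unfolding \<pi>x by simp
  qed
  have bound: "integrable disc_area \<psi>" if "continuous_on UNIV \<psi>" for \<psi> :: "complex \<Rightarrow> real"
    by (intro continuous_closed_disc_integrable continuous_on_subset[OF that]) auto
  define K where "K = (real d + real k) * B + real k * B * (LINT w|disc_area. inverse (cmod w)) + B"
  have main: "cmod C * ((\<Sum>i<Suc N. 1 / (real i + 1)) - 1) \<le> K" for N
  proof -
    let ?p = "\<pi> (Suc N)" and ?r = "\<rho> N"
    define U where "U w = (of_nat (d + k)) * (?h w * norm_sq w ^ d) * of_real (?p w) - of_nat k * ?h w * of_real (?p w)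
        + ?h w * (norm_sq w ^ d - 1) * of_real (?r w)" for w
    \<comment> \<open>\<open>U\<close> collects the terms with \<open>g\<close>, after replacing \<open>x P'\<close> by \<open>\<rho> - \<pi>\<close>.\<close>
    define V where "V w = (1 - ?x w ^ n) * ?p w" for w
    have "(LINT w|disc_area. H0 w * poly (P (Suc N)) (norm_sq w) + H1 w * (norm_sq w * poly (pderiv (P (Suc N))) (norm_sq w))) = 0"
      unfolding diagonal_polynomial_functional[OF H0 H1] by (simp only: zero) simp
    moreover have "H0 w * poly (P (Suc N)) (norm_sq w) + H1 w * (norm_sq w * poly (pderiv (P (Suc N))) (norm_sq w))
        = U w - C * of_real (V w)" for w
    proof -
      have *: "norm_sq w * poly (pderiv (P (Suc N))) (norm_sq w) = of_real (?r w) - of_real (?p w)"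
        using P\<rho>[of N w] P\<pi>[of "Suc N" w] by (simp add: algebra_simps)
      show ?thesis
        unfolding * P\<pi> H0_def H1_def U_def V_def by (simp add: algebra_simps)
    qed
    ultimately have "(LINT w|disc_area. U w - C * of_real (V w)) = 0" by simp
    moreover have Vi: "integrable disc_area V"
      unfolding V_def by (intro bound continuous_intros cont)
    moreover have hc: "integrable disc_area (\<lambda>w. ?h w * \<psi> w)" if "continuous_on UNIV \<psi>" for \<psi>
      by (intro continuous_closed_disc_mult_integrable h continuous_on_subset[OF that]) auto
    have Ui: "integrable disc_area U"
    proof -
      have "integrable disc_area (\<lambda>w. ?h w * (of_nat (d + k) * norm_sq w ^ d * of_real (?p w) - of_nat k * of_real (?p w) + (norm_sq w ^ d - 1) * of_real (?r w)))"
        by (intro hc continuous_intros cont)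
      then show ?thesis unfolding U_def by (simp add: algebra_simps)
    qed
    ultimately have UV: "(LINT w|disc_area. U w) = C * of_real (LINT w|disc_area. V w)"
      by (simp add: integral_complex_of_real)
    have "cmod (LINT w|disc_area. U w) \<le> K"
    proof -
      have "cmod (LINT w|disc_area. U w) \<le> (LINT w|disc_area. cmod (U w))"
        by (rule integral_norm_bound)
      also have "\<dots> \<le> (LINT w|disc_area. (real d + real k) * B + real k * B * inverse (cmod w) + B * ?r w)"
      proof (rule integral_mono_AE)
        show "integrable disc_area (\<lambda>w. cmod (U w))" using Ui by simp
        show "integrable disc_area (\<lambda>w. (real d + real k) * B + real k * B * inverse (cmod w) + B * ?r w)"
          by (intro Bochner_Integration.integrable_add integrable_mult_right integrable_inverse_norm bound cont continuous_intros)
        show "AE w in disc_area. cmod (U w) \<le> (real d + real k) * B + real k * B * inverse (cmod w) + B * ?r w"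
          using B AE_disc_nonzero AE_space
        proof eventually_elim
          case (elim w)
          have w1: "cmod w < 1" using elim by (simp add: space_disc_area)
          have hB: "cmod (?h w) \<le> B * cmod w ^ k"
            using elim by (simp add: norm_mult norm_power mult_right_mono)
          have hB1: "cmod (?h w) \<le> B"
            using hB w1 \<open>0 \<le> B\<close> by (meson less_imp_le mult_left_le norm_ge_zero order_trans power_le_one)
          note px = pos[OF elim(3)]
          have dx: "?x w ^ d * ?p w \<le> 1"
          proof -
            have "?x w ^ d \<le> ?x w ^ 1" using x[OF elim(3)] d by (intro power_decreasing) auto
            then have "?x w ^ d * ?p w \<le> ?x w * ?p w" using px by (intro mult_right_mono) auto
            then show ?thesis using px(3)[of "Suc N"] by (simp add: mult.commute)
          qed
          have t1: "cmod (?h w) * (?x w ^ d * ?p w) \<le> B * 1"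
            using hB1 dx px \<open>0 \<le> B\<close> x[OF elim(3)] by (intro mult_mono) auto
          have t2: "real k * (cmod (?h w) * ?p w) \<le> real k * (B * inverse (cmod w))"
          proof (cases "k = 0")
            case False
            have "cmod w ^ k * ?p w \<le> inverse (cmod w)"
            proof -
              have "cmod w ^ k \<le> cmod w ^ 1" using w1 False by (intro power_decreasing) auto
              then have "cmod w ^ k * ?p w \<le> cmod w * ?p w" using px by (intro mult_right_mono) auto
              also have "\<dots> \<le> inverse (cmod w)"
                using px(3)[of "Suc N"] elim(2) by (simp add: field_simps power2_eq_square)
              finally show ?thesis .
            qed
            then have "B * (cmod w ^ k * ?p w) \<le> B * inverse (cmod w)" using \<open>0 \<le> B\<close> by (intro mult_left_mono)
            moreover have "cmod (?h w) * ?p w \<le> B * cmod w ^ k * ?p w" using hB px by (intro mult_right_mono) auto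
            ultimately have "cmod (?h w) * ?p w \<le> B * inverse (cmod w)" by (simp add: mult.assoc)
            then show ?thesis by (intro mult_left_mono) auto
          qed simp
          have t3: "cmod (?h w) * cmod (norm_sq w ^ d - 1) * ?r w \<le> B * ?r w"
          proof -
            have "norm_sq w ^ d - 1 = of_real (?x w ^ d - 1)" by simp
            then have "cmod (norm_sq w ^ d - 1) = \<bar>?x w ^ d - 1\<bar>" by (simp only: norm_of_real)
            also have "\<dots> \<le> 1"
              using power_le_one[of "?x w" d] zero_le_power[of "?x w" d] x[OF elim(3)] by (simp add: abs_le_iff)
            finally have "cmod (?h w) * cmod (norm_sq w ^ d - 1) \<le> B * 1"
              using hB1 \<open>0 \<le> B\<close> by (intro mult_mono) auto
            then show ?thesis using px by (intro mult_right_mono) auto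
          qed
          have "cmod (U w) \<le> cmod (of_nat (d + k) * (?h w * norm_sq w ^ d) * of_real (?p w)) + cmod (of_nat k * ?h w * of_real (?p w))
              + cmod (?h w * (norm_sq w ^ d - 1) * of_real (?r w))"
            unfolding U_def by (intro norm_triangle_le norm_triangle_le_diff order_refl add_mono)
          also have "\<dots> = real (d + k) * (cmod (?h w) * (?x w ^ d * ?p w)) + real k * (cmod (?h w) * ?p w)
              + cmod (?h w) * cmod (norm_sq w ^ d - 1) * ?r w"
            using px[of "Suc N"] px[of N] x[OF elim(3)]
            by (simp only: norm_mult norm_of_nat norm_of_real norm_power abs_of_nonneg mult_ac)
          also have "\<dots> \<le> real (d + k) * (B * 1) + real k * (B * inverse (cmod w)) + B * ?r w"
            by (intro add_mono mult_left_mono t1 t2 t3) auto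
          finally show ?case by (simp add: algebra_simps)
        qed
      qed
      also have "\<dots> = K"
      proof -
        have "(LINT w|disc_area. ?r w) = 1"
          unfolding \<rho>_def by (simp add: integral_one_minus_norm_sq_power add.commute del: of_nat_Suc)
        moreover have "integrable disc_area ?r" by (intro bound cont)
        moreover have "measure disc_area (space disc_area) = 1"
          by (simp add: measure_def space_disc_area emeasure_disc_area_total)
        moreover have "integrable disc_area (\<lambda>w. (real d + real k) * B)"
          by (rule finite_measure.integrable_const[OF finite_measure_disc_area])
        ultimately show ?thesis
          using integrable_inverse_norm
          by (subst Bochner_Integration.integral_add, simp, simp, subst Bochner_Integration.integral_add, simp, simp)
            (simp add: K_def)
      qed
      finally show ?thesis .
    qed
    moreover have "(\<Sum>i<Suc N. 1 / (real i + 1)) - 1 \<le> (LINT w|disc_area. V w)"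
    proof -
      have "(LINT w|disc_area. ?p w) = (\<Sum>i<Suc N. 1 / (real i + 1))"
        unfolding \<pi>_def by (subst Bochner_Integration.integral_sum)
          (simp_all only: integral_one_minus_norm_sq_power bound continuous_intros)
      moreover have "(LINT w|disc_area. ?p w - 1) \<le> (LINT w|disc_area. V w)"
      proof (rule integral_mono)
        show "?p w - 1 \<le> V w" if "w \<in> space disc_area" for w
        proof -
          have "?x w ^ n \<le> ?x w ^ 1" using x[OF that] n by (intro power_decreasing) auto
          then have "?x w ^ n * ?p w \<le> ?x w * ?p w" using pos[OF that] by (intro mult_right_mono) auto
          then show ?thesis using pos(3)[OF that, of "Suc N"] by (simp add: V_def algebra_simps)
        qed
      qed (intro Vi bound cont continuous_intros)+
      moreover have "(LINT w|disc_area. ?p w - 1) = (LINT w|disc_area. ?p w) - 1"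
      proof -
        have "measure disc_area (space disc_area) = 1"
          by (simp add: measure_def space_disc_area emeasure_disc_area_total)
        moreover have "integrable disc_area (\<lambda>w. 1 :: real)"
          by (rule finite_measure.integrable_const[OF finite_measure_disc_area])
        ultimately show ?thesis
          using bound[OF cont(1)[of "Suc N"]] by (subst Bochner_Integration.integral_diff) simp_all
      qed
      ultimately show ?thesis by simp
    qed
    moreover have "cmod (LINT w|disc_area. U w) \<ge> cmod C * (LINT w|disc_area. V w)"
      unfolding UV by (simp add: norm_mult mult_left_mono)
    ultimately show ?thesis
      by (meson mult_left_mono norm_ge_zero order_trans)
  qed
  have "\<not> summable (\<lambda>i. 1 / (real i + 1))"
    using not_summable_harmonic[where 'a=real] summable_Suc_iff[of "\<lambda>i. 1 / real i"]
    by (simp add: inverse_eq_divide add.commute)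
  moreover have "summable (\<lambda>i. 1 / (real i + 1))"
  proof (rule summableI_nonneg_bounded)
    show "(\<Sum>i<N. 1 / (real i + 1)) \<le> K / cmod C + 1" for N
    proof -
      have "(\<Sum>i<N. 1 / (real i + 1)) \<le> (\<Sum>i<Suc N. 1 / (real i + 1))" by simp
      moreover have "(\<Sum>i<Suc N. 1 / (real i + 1)) - 1 \<le> K / cmod C"
        using main[of N] \<open>C \<noteq> 0\<close> by (simp add: pos_le_divide_eq mult.commute)
      ultimately show ?thesis by linarith
    qed
  qed auto
  ultimately show False by blast
qed

section \<open>Banded matrices commuting with a harmonic symbol\<close>

text \<open>
  The entries above the diagonal \<open>l - j = k\<close> vanish. The number \<open>k\<close> may be negative.
\<close>

definition band_le :: "int \<Rightarrow> (nat \<Rightarrow> nat \<Rightarrow> complex) \<Rightarrow> bool"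
  where "band_le k A \<longleftrightarrow> (\<forall>j l. int l - int j > k \<longrightarrow> A j l = 0)"

lemma band_leD: "band_le k A \<Longrightarrow> int l - int j > k \<Longrightarrow> A j l = 0"
  by (simp add: band_le_def)

lemma mat_prod_add_left: "mat_prod L (\<lambda>j l. A j l + B j l) C j l = mat_prod L A C j l + mat_prod L B C j l"
  and mat_prod_add_right: "mat_prod L C (\<lambda>j l. A j l + B j l) j l = mat_prod L C A j l + mat_prod L C B j l"
  by (simp_all add: mat_prod_def algebra_simps sum.distrib)

lemma mat_prod_above_band:
  assumes "band_le a A" "band_le b B" "int l - int j > a + b"
  shows "mat_prod L A B j l = 0"
  unfolding mat_prod_def
proof (intro sum.neutral ballI)
  fix i
  have "int i - int j > a \<or> int l - int i > b" using assms(3) by linarith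
  then show "A j i * B i l = 0" using band_leD[OF assms(1)] band_leD[OF assms(2)] by auto
qed

text \<open>
  On the highest diagonal that a product of banded matrices can reach, a single summand survives.
\<close>

lemma mat_prod_top_band:
  assumes "band_le a A" "band_le b B" "int l - int j = a + b" "int j + a \<le> int L"
  shows "mat_prod L A B j l = (if int j + a \<ge> 0 then A j (nat (int j + a)) * B (nat (int j + a)) l else 0)"
proof -
  have "A j i * B i l = (if int i = int j + a then A j (nat (int j + a)) * B (nat (int j + a)) l else 0)" for i
  proof (cases "int i = int j + a")
    case True
    then have "i = nat (int j + a)" by simp
    then show ?thesis using True by simp
  next
    case False
    then have "int i - int j > a \<or> int l - int i > b" using assms(3) by linarith
    then show ?thesis using False band_leD[OF assms(1)] band_leD[OF assms(2)] by auto
  qed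
  then have "mat_prod L A B j l = (\<Sum>i\<le>L. if int i = int j + a then A j (nat (int j + a)) * B (nat (int j + a)) l else 0)"
    by (simp add: mat_prod_def)
  also have "\<dots> = (if int j + a \<ge> 0 then A j (nat (int j + a)) * B (nat (int j + a)) l else 0)"
  proof (cases "int j + a \<ge> 0")
    case True
    then have "(int i = int j + a) = (i = nat (int j + a))" for i by auto
    then show ?thesis using True assms(4) by (simp add: sum.delta)
  next
    case False
    then have "int i \<noteq> int j + a" for i by auto
    then show ?thesis using False by simp
  qed
  finally show ?thesis .
qed

text \<open>
  The matrix of multiplication by the polynomial \<open>r\<close>.
\<close>

definition analytic_matrix :: "complex poly \<Rightarrow> nat \<Rightarrow> nat \<Rightarrow> complex"
  where "analytic_matrix r j l = (if j \<le> l then coeff r (l - j) else 0)"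

lemma analytic_matrix_0 [simp]: "analytic_matrix 0 j l = 0"
  by (cases "j \<le> l") (simp_all add: analytic_matrix_def)

lemma band_analytic: "degree r \<le> n \<Longrightarrow> band_le (int n) (analytic_matrix r)"
  by (auto simp: band_le_def analytic_matrix_def intro!: coeff_eq_0)

lemma analytic_matrix_shift: "analytic_matrix r (j + i) (l + i) = analytic_matrix r j l"
  by (simp add: analytic_matrix_def)

lemma mat_prod_analytic_commute:
  assumes "l \<le> L"
  shows "mat_prod L (analytic_matrix p) (analytic_matrix r) j l = mat_prod L (analytic_matrix r) (analytic_matrix p) j l"
proof -
  have *: "mat_prod L (analytic_matrix p) (analytic_matrix r) j l = (\<Sum>i\<in>{j..l}. coeff p (i - j) * coeff r (l - i))" for p r
    unfolding mat_prod_def using assms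
    by (intro sum.mono_neutral_cong_right) (auto simp: analytic_matrix_def)
  show ?thesis
    unfolding *
    by (rule sum.reindex_bij_witness[of _ "\<lambda>i. j + l - i" "\<lambda>i. j + l - i"]) (auto simp: mult.commute)
qed

text \<open>
  The matrix of a harmonic symbol with analytic part \<open>p\<close>, whose anti-analytic part has the
  conjugated Taylor coefficients \<open>q\<close> and begins in degree \<open>m\<close>.
\<close>

locale harmonic_symbol =
  fixes p :: "complex poly" and q :: "nat \<Rightarrow> complex" and m :: nat
  assumes degree_p: "degree p > 0" and m_pos: "m > 0" and q_m: "q m \<noteq> 0"
    and q_below: "\<And>i. i < m \<Longrightarrow> q i = 0"
begin

abbreviation d :: nat where "d \<equiv> degree p"

definition coanalytic_matrix :: "nat \<Rightarrow> nat \<Rightarrow> complex"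
  where "coanalytic_matrix j l = (if j \<le> l then 0 else q (j - l) * (of_nat l + 1) / (of_nat j + 1))"

definition symbol_entry :: "nat \<Rightarrow> nat \<Rightarrow> complex"
  where "symbol_entry j l = analytic_matrix p j l + coanalytic_matrix j l"

definition commutes :: "(nat \<Rightarrow> nat \<Rightarrow> complex) \<Rightarrow> bool"
  where "commutes e \<longleftrightarrow> (\<exists>K. \<forall>L j l. L \<ge> j + K \<longrightarrow> mat_prod L symbol_entry e j l = mat_prod L e symbol_entry j l)"

lemma lead: "coeff p d \<noteq> 0"
  using degree_p by auto

lemma band_coanalytic: "band_le (- int m) coanalytic_matrix"
  unfolding band_le_def
proof (intro allI impI)
  fix j l assume "- int m < int l - int j"
  then show "coanalytic_matrix j l = 0"
    using q_below[of "j - l"] by (simp add: coanalytic_matrix_def)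
qed

lemma band_symbol_entry: "band_le (int d) symbol_entry"
  unfolding band_le_def
proof (intro allI impI)
  fix j l assume "int d < int l - int j"
  then show "symbol_entry j l = 0"
    using band_leD[OF band_analytic[of p d], of l j] by (simp add: symbol_entry_def coanalytic_matrix_def)
qed

lemma symbol_entry_top: "symbol_entry j (j + d) = coeff p d"
  by (simp add: symbol_entry_def analytic_matrix_def coanalytic_matrix_def)

text \<open>
  Split the given matrix as the matrix of a polynomial \<open>r\<close> plus a remainder with top diagonal \<open>k\<close>. In
  the commutator with the remainder, only the leading coefficient of \<open>p\<close> acts on the diagonal \<open>k + d\<close>.
  Multiplication by \<open>r\<close> commutes with multiplication by \<open>p\<close>, so \<open>r\<close> contributes only through the
  co-analytic part. Subtracting the matrix of \<open>r\<close> does not change the left-hand side, since that matrix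
  is constant on diagonals.
\<close>

lemma commutator_top_diagonal:
  assumes comm: "commutes e" and r: "degree r \<le> n"
    and band: "band_le k (\<lambda>j l. e j l - analytic_matrix r j l)"
    and l: "int l = int j + k + int d"
  obtains L where "L \<ge> j + n + l"
    "coeff p d * (e (j + d) l - (if d \<le> l then e j (l - d) else 0))
      = mat_prod L (analytic_matrix r) coanalytic_matrix j l - mat_prod L coanalytic_matrix (analytic_matrix r) j l"
proof -
  from comm obtain K where K: "\<And>L j l. L \<ge> j + K \<Longrightarrow> mat_prod L symbol_entry e j l = mat_prod L e symbol_entry j l"
    unfolding commutes_def by blast
  define L where "L = j + K + d + n + l"
  define e' where "e' j l = e j l - analytic_matrix r j l" for j l
  have e: "e = (\<lambda>j l. analytic_matrix r j l + e' j l)" by (simp add: e'_def)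
  have symbol_entry: "symbol_entry = (\<lambda>j l. analytic_matrix p j l + coanalytic_matrix j l)" by (simp add: symbol_entry_def fun_eq_iff)
  have band': "band_le k e'" using band by (simp add: e'_def[abs_def])
  have t1: "mat_prod L symbol_entry e' j l = coeff p d * e' (j + d) l"
  proof -
    have "nat (int j + int d) = j + d" by simp
    then show ?thesis
      using mat_prod_top_band[OF band_symbol_entry band', of l j L] l by (simp add: L_def symbol_entry_top nat_int_add)
  qed
  have t2: "mat_prod L e' symbol_entry j l = coeff p d * (if d \<le> l then e' j (l - d) else 0)"
  proof (cases "d \<le> l")
    case True
    then have "nat (int j + k) = l - d" "int j + k \<ge> 0" using l by auto
    then show ?thesis
      using mat_prod_top_band[OF band' band_symbol_entry, of l j L] l True symbol_entry_top[of "l - d"] by (simp add: L_def)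
  next
    case False
    then have "\<not> int j + k \<ge> 0" using l by auto
    then show ?thesis
      using mat_prod_top_band[OF band' band_symbol_entry, of l j L] l False by (simp add: L_def)
  qed
  have "mat_prod L symbol_entry (analytic_matrix r) j l + mat_prod L symbol_entry e' j l
      = mat_prod L (analytic_matrix r) symbol_entry j l + mat_prod L e' symbol_entry j l"
    using K[of j L l] unfolding mat_prod_add_left[symmetric] mat_prod_add_right[symmetric] e[symmetric]
    by (simp add: L_def)
  moreover have "mat_prod L symbol_entry (analytic_matrix r) j l = mat_prod L (analytic_matrix p) (analytic_matrix r) j l + mat_prod L coanalytic_matrix (analytic_matrix r) j l"
    unfolding symbol_entry by (rule mat_prod_add_left)
  moreover have "mat_prod L (analytic_matrix r) symbol_entry j l = mat_prod L (analytic_matrix r) (analytic_matrix p) j l + mat_prod L (analytic_matrix r) coanalytic_matrix j l"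
    unfolding symbol_entry by (rule mat_prod_add_right)
  moreover have "mat_prod L (analytic_matrix p) (analytic_matrix r) j l = mat_prod L (analytic_matrix r) (analytic_matrix p) j l"
    by (rule mat_prod_analytic_commute) (simp add: L_def)
  ultimately have "coeff p d * (e' (j + d) l - (if d \<le> l then e' j (l - d) else 0))
      = mat_prod L (analytic_matrix r) coanalytic_matrix j l - mat_prod L coanalytic_matrix (analytic_matrix r) j l"
    unfolding t1 t2 by (simp add: algebra_simps)
  moreover have "e' (j + d) l - (if d \<le> l then e' j (l - d) else 0) = e (j + d) l - (if d \<le> l then e j (l - d) else 0)"
    using analytic_matrix_shift[of r j d "l - d"] by (auto simp: e'_def analytic_matrix_def)
  ultimately show thesis
    by (intro that[of L]) (simp_all add: L_def)
qed

text \<open>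
  Here the commutator of \<open>r\<close> with the co-analytic part does not reach the diagonal \<open>k + d\<close>. So the
  \<open>k\<close>-th diagonal has period \<open>d\<close>, and slow variation makes it constant. For \<open>k < 0\<close>, entries of the
  relation that would fall outside the matrix count as zero, and so the constant is zero.
\<close>

lemma diagonal_constant:
  assumes g: "integrable disc_area g" and e: "e = toeplitz_entry g" and comm: "commutes e"
    and r: "degree r \<le> n" and band: "band_le k (\<lambda>j l. e j l - analytic_matrix r j l)"
    and k: "r = 0 \<or> k > int n - int m - int d"
  obtains \<gamma> where "\<And>j l. int l - int j = k \<Longrightarrow> e j l - analytic_matrix r j l = \<gamma>" "k < 0 \<Longrightarrow> \<gamma> = 0"
proof -
  define e' where "e' j l = e j l - analytic_matrix r j l" for j l
  have rel: "e (j + d) l = (if d \<le> l then e j (l - d) else 0)" if l: "int l = int j + k + int d" for j l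
  proof -
    from commutator_top_diagonal[OF comm r band l] obtain L where
      L: "coeff p d * (e (j + d) l - (if d \<le> l then e j (l - d) else 0))
      = mat_prod L (analytic_matrix r) coanalytic_matrix j l - mat_prod L coanalytic_matrix (analytic_matrix r) j l" by metis
    have "mat_prod L (analytic_matrix r) coanalytic_matrix j l = 0 \<and> mat_prod L coanalytic_matrix (analytic_matrix r) j l = 0"
    proof (cases "r = 0")
      case True
      then show ?thesis by (simp add: mat_prod_def)
    next
      case False
      then show ?thesis
        using k l mat_prod_above_band[OF band_analytic[OF r] band_coanalytic, of l j]
          mat_prod_above_band[OF band_coanalytic band_analytic[OF r], of l j] by simp
    qed
    then show ?thesis using L lead by simp
  qed
  have step: "e' (j + d) (l + d) = e' j l" if "int l - int j = k" for j l
    using rel[of "l + d" j] that analytic_matrix_shift[of r j d l] by (simp add: e'_def)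
  have steps: "e' (j + t * d) (l + t * d) = e' j l" if "int l - int j = k" for j l t
  proof (induction t)
    case (Suc t)
    then show ?case using step[of "l + t * d" "j + t * d"] that by (simp add: add_ac)
  qed simp
  have succ: "e' (j + 1) (l + 1) = e' j l" if jl: "int l - int j = k" for j l
  proof -
    have "filterlim (\<lambda>t. t * d) sequentially sequentially"
      using degree_p by (intro filterlim_subseq) (simp add: strict_mono_def)
    from filterlim_compose[OF toeplitz_entry_slowly_varying[OF g, of j l] this]
    have "(\<lambda>t. e (j + Suc (t * d)) (l + Suc (t * d)) - e (j + t * d) (l + t * d)) \<longlonglongrightarrow> 0"
      by (simp add: e o_def)
    moreover have "e (j + Suc (t * d)) (l + Suc (t * d)) - e (j + t * d) (l + t * d) = e' (j + 1) (l + 1) - e' j l" for t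
    proof -
      have "e (j + Suc (t * d)) (l + Suc (t * d)) - e (j + t * d) (l + t * d)
          = e' (j + 1 + t * d) (l + 1 + t * d) - e' (j + t * d) (l + t * d)"
        using analytic_matrix_shift[of r "j + t * d" 1 "l + t * d"] by (simp add: e'_def)
      then show ?thesis using steps[of "l + 1" "j + 1" t] steps[of l j t] jl by simp
    qed
    ultimately show ?thesis by (simp add: LIMSEQ_const_iff)
  qed
  have along: "e' (j + t) (l + t) = e' j l" if "int l - int j = k" for j l t
  proof (induction t)
    case (Suc t)
    then show ?case using succ[of "l + t" "j + t"] that by simp
  qed simp
  define \<gamma> where "\<gamma> = e' (nat (- k)) (nat k)"
  have const: "e' j l = \<gamma>" if "int l - int j = k" for j l
  proof -
    define t where "t = min j l"
    have "j = nat (- k) + t" "l = nat k + t" using that by (auto simp: t_def)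
    then show ?thesis using along[of "nat k" "nat (- k)" t] by (simp add: \<gamma>_def)
  qed
  have "\<gamma> = 0" if "k < 0"
  proof -
    \<comment> \<open>The largest \<open>j\<close> for which the entry with column \<open>j + k\<close> is missing.\<close>
    define j where "j = nat (- k) - 1"
    have j: "int (d - 1) = int j + k + int d" using that degree_p by (auto simp: j_def)
    from rel[OF j] degree_p have "e (j + d) (d - 1) = 0" by simp
    moreover have "analytic_matrix r (j + d) (d - 1) = 0" using degree_p by (simp add: analytic_matrix_def)
    moreover have "e' (j + d) (d - 1) = \<gamma>" using j by (intro const) simp
    ultimately show ?thesis by (simp add: e'_def)
  qed
  with const show thesis by (intro that[of \<gamma>]) (auto simp: e'_def)
qed

lemma negative_band_vanishes:
  assumes g: "integrable disc_area g" and comm: "commutes (toeplitz_entry g)"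
    and band: "band_le n (toeplitz_entry g)" and n: "n < 0"
  shows "toeplitz_entry g j l = 0"
proof -
  have "band_le (n - int t) (toeplitz_entry g)" for t
  proof (induction t)
    case 0 then show ?case using band by simp
  next
    case (Suc t)
    have "band_le (n - int t) (\<lambda>j l. toeplitz_entry g j l - analytic_matrix 0 j l)"
      using Suc by simp
    from diagonal_constant[OF g refl comm _ this, of 0] obtain \<gamma>
      where \<gamma>: "\<And>j l. int l - int j = n - int t \<Longrightarrow> toeplitz_entry g j l - analytic_matrix 0 j l = \<gamma>"
        "n - int t < 0 \<Longrightarrow> \<gamma> = 0" by auto
    show ?case unfolding band_le_def
    proof (intro allI impI)
      fix j l assume "n - int (Suc t) < int l - int j"
      then consider "int l - int j = n - int t" | "int l - int j > n - int t" by linarith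
      then show "toeplitz_entry g j l = 0"
        using \<gamma> n Suc by cases (auto simp: band_le_def)
    qed
  qed
  from band_leD[OF this[of "nat (n + int j - int l) + 1"]] show ?thesis by simp
qed

text \<open>
  Each of the top \<open>m + d\<close> diagonals agrees with that of a polynomial: peel them off one at a time.
\<close>

lemma analytic_upper_diagonals:
  assumes g: "integrable disc_area g" and comm: "commutes (toeplitz_entry g)"
    and band: "band_le (int n) (toeplitz_entry g)"
    and t: "t \<le> m + d"
  shows "\<exists>r. degree r \<le> n \<and> band_le (int n - int t) (\<lambda>j l. toeplitz_entry g j l - analytic_matrix r j l)"
  using t
proof (induction t)
  case 0
  then show ?case using band by (intro exI[of _ 0]) simp
next
  case (Suc t)
  let ?k = "int n - int t"
  from Suc obtain r where r: "degree r \<le> n"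
    and br: "band_le ?k (\<lambda>j l. toeplitz_entry g j l - analytic_matrix r j l)" by auto
  from diagonal_constant[OF g refl comm r br] Suc.prems obtain \<gamma>
    where \<gamma>: "\<And>j l. int l - int j = ?k \<Longrightarrow> toeplitz_entry g j l - analytic_matrix r j l = \<gamma>"
      "?k < 0 \<Longrightarrow> \<gamma> = 0" by (metis (no_types, opaque_lifting) diff_diff_eq of_nat_add of_nat_less_iff Suc_le_lessD diff_strict_left_mono)
  define r' where "r' = r + monom \<gamma> (nat ?k)"
  have "degree r' \<le> n"
    unfolding r'_def using r by (intro degree_add_le order_trans[OF degree_monom_le]) auto
  moreover have "band_le (int n - int (Suc t)) (\<lambda>j l. toeplitz_entry g j l - analytic_matrix r' j l)"
    unfolding band_le_def
  proof (intro allI impI)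
    fix j l assume "int n - int (Suc t) < int l - int j"
    then consider "int l - int j = ?k" | "int l - int j > ?k" by linarith
    then show "toeplitz_entry g j l - analytic_matrix r' j l = 0"
    proof cases
      case 1
      then have "analytic_matrix r' j l = analytic_matrix r j l + (if j \<le> l then \<gamma> else 0)"
        by (auto simp: analytic_matrix_def r'_def)
      moreover have "j \<le> l \<longleftrightarrow> ?k \<ge> 0" using 1 by auto
      ultimately show ?thesis using \<gamma>(1)[OF 1] \<gamma>(2) by (auto simp: algebra_simps)
    next
      case 2
      then have "coeff (monom \<gamma> (nat ?k)) (l - j) = 0" if "j \<le> l"
        using that \<gamma>(2) by (cases "?k \<ge> 0") auto
      then have "analytic_matrix r' j l = analytic_matrix r j l"
        by (auto simp: analytic_matrix_def r'_def)
      then show ?thesis using band_leD[OF br 2] by simp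
    qed
  qed
  ultimately show ?case by blast
qed

text \<open>
  On this diagonal the top coefficient of the polynomial from the preceding lemma, which is the entry
  \<open>e 0 n\<close>, meets the lowest co-analytic coefficient \<open>q m\<close>. The case distinction on \<open>m \<le> j\<close> records that the
  co-analytic part annihilates the monomials of degree below \<open>m\<close>.
\<close>

lemma critical_diagonal:
  assumes g: "integrable disc_area g" and e: "e = toeplitz_entry g" and comm: "commutes e"
    and band: "band_le (int n) e" and l: "l + m = j + n"
  shows "coeff p d * (e (j + d) l - (if d \<le> l then e j (l - d) else 0))
    = e 0 n * q m * ((of_nat l + 1) / (of_nat j + of_nat n + 1)
        - (if m \<le> j then (of_nat j - of_nat m + 1) / (of_nat j + 1) else 0))"
proof -
  from analytic_upper_diagonals[of g n "m + d"] g comm band obtain r where r: "degree r \<le> n"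
    and br: "band_le (int n - int (m + d)) (\<lambda>j l. e j l - analytic_matrix r j l)" by (auto simp: e)
  have rn: "coeff r n = e 0 n"
    using band_leD[OF br, of n 0] m_pos by (simp add: analytic_matrix_def)
  have l': "int l = int j + (int n - int (m + d)) + int d" using l by simp
  from commutator_top_diagonal[OF comm r br l'] obtain L where L: "L \<ge> j + n + l"
    "coeff p d * (e (j + d) l - (if d \<le> l then e j (l - d) else 0))
      = mat_prod L (analytic_matrix r) coanalytic_matrix j l - mat_prod L coanalytic_matrix (analytic_matrix r) j l" by metis
  have "j + n - l = m" "l < j + n" using l m_pos by auto
  then have "mat_prod L (analytic_matrix r) coanalytic_matrix j l = e 0 n * (q m * (of_nat l + 1) / (of_nat (j + n) + 1))"
    using mat_prod_top_band[OF band_analytic[OF r] band_coanalytic, of l j L] l L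
    by (simp add: nat_int_add analytic_matrix_def rn coanalytic_matrix_def)
  moreover have "mat_prod L coanalytic_matrix (analytic_matrix r) j l
      = (if m \<le> j then q m * (of_nat j - of_nat m + 1) / (of_nat j + 1) * e 0 n else 0)"
  proof (cases "m \<le> j")
    case True
    then have "nat (int j - int m) = j - m" "l - (j - m) = n" "j - m \<le> l" "j - (j - m) = m" "\<not> j \<le> j - m"
      using l m_pos by auto
    then show ?thesis
      using mat_prod_top_band[OF band_coanalytic band_analytic[OF r], of l j L] l L True
      by (simp add: analytic_matrix_def rn coanalytic_matrix_def of_nat_diff)
  next
    case False
    then show ?thesis
      using mat_prod_top_band[OF band_coanalytic band_analytic[OF r], of l j L] l L by simp
  qed
  ultimately show ?thesis unfolding L(2) by (simp add: algebra_simps)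
qed

section \<open>The critical diagonal\<close>

definition weight :: "nat \<Rightarrow> nat \<Rightarrow> real"
  where "weight n j = real m / (real j + 1) - real m / (real j + real n + 1)"

lemma weight_strict_decreasing:
  assumes "n > 0"
  shows "weight n (Suc j) < weight n j"
proof -
  have eq: "weight n i = real m * real n / ((real i + 1) * (real i + real n + 1))" for i
    by (simp add: weight_def field_simps)
  show ?thesis
    unfolding eq using assms m_pos
    by (intro divide_strict_left_mono mult_strict_mono mult_pos_pos) auto
qed

text \<open>
  The two formulas overlap at \<open>j = m - 1\<close>, where the truncated term vanishes anyway. They
  disagree for all smaller \<open>j\<close>.
\<close>

lemma critical_recurrence:
  assumes g: "integrable disc_area g" and e: "e = toeplitz_entry g" and comm: "commutes e"
    and band: "band_le (int n) e" and l: "l + m = j + n"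
    and C: "C = e 0 n * q m / coeff p d"
  shows "j < m \<Longrightarrow> e (j + d) l - (if d \<le> l then e j (l - d) else 0) = C * of_real (1 - real m / (real j + real n + 1))"
    and "m \<le> j + 1 \<Longrightarrow> e (j + d) l - (if d \<le> l then e j (l - d) else 0) = C * of_real (weight n j)"
proof -
  let ?X = "e (j + d) l - (if d \<le> l then e j (l - d) else 0)"
  have X: "?X = C * ((of_nat l + 1) / (of_nat j + of_nat n + 1)
        - (if m \<le> j then (of_nat j - of_nat m + 1) / (of_nat j + 1) else 0))"
    using critical_diagonal[OF g e comm band l] lead by (simp add: C field_simps)
  have "complex_of_nat l = of_nat j + of_nat n - of_nat m"
    using l by (metis add_diff_cancel_right' of_nat_add)
  moreover have "complex_of_nat j + of_nat n + 1 = of_nat (Suc (j + n))" "complex_of_nat j + 1 = of_nat (Suc j)" by simp_all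
  then have nz: "complex_of_nat j + of_nat n + 1 \<noteq> 0" "complex_of_nat j + 1 \<noteq> 0"
    by (simp_all only: of_nat_neq_0 not_False_eq_True)
  ultimately have A: "(of_nat l + 1) / (of_nat j + of_nat n + 1) = (of_real (1 - real m / (real j + real n + 1)) :: complex)"
    by (simp add: divide_simps)
  have B: "(of_nat j - of_nat m + 1) / (of_nat j + 1) = (of_real (1 - real m / (real j + 1)) :: complex)"
    using nz by (simp add: divide_simps)
  show "?X = C * of_real (1 - real m / (real j + real n + 1))" if "j < m"
    unfolding X A using that by simp
  show "?X = C * of_real (weight n j)" if "m \<le> j + 1"
  proof (cases "m \<le> j")
    case True
    show ?thesis unfolding X A B using True by (simp add: weight_def)
  next
    case False
    then have "real m = real j + 1" using that by simp
    then show ?thesis unfolding X A using False by (simp add: weight_def)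
  qed
qed

text \<open>
  If \<open>n < d\<close>, the recurrence has no second term at \<open>j = m - 1\<close> and at \<open>j = m\<close>, so the entries on
  both chains with step \<open>d\<close> are explicit partial sums of weights. The weights decrease strictly, so the
  two partial sums differ by at least a fixed amount, while neighbouring entries approach each other.
\<close>

lemma top_degree_not_below:
  assumes g: "integrable disc_area g" and comm: "commutes (toeplitz_entry g)"
    and band: "band_le (int n) (toeplitz_entry g)" and n: "0 < n" "n < d"
  shows "toeplitz_entry g 0 n = 0"
proof -
  define e where "e = toeplitz_entry g"
  define C where "C = e 0 n * q m / coeff p d"
  note rec = critical_recurrence(2)[OF g e_def comm[folded e_def] band[folded e_def] _ C_def]
  have chain: "e (j + Suc i * d) (l + i * d) = C * of_real (\<Sum>t\<le>i. weight n (j + t * d))"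
    if j: "m \<le> j + 1" and l: "l + m = j + n" "l < d" for i j l
  proof (induction i)
    case 0
    then show ?case using rec[OF l(1) j] l(2) by simp
  next
    case (Suc i)
    have "e (j + Suc i * d + d) (l + Suc i * d) - e (j + Suc i * d) (l + i * d) = C * of_real (weight n (j + Suc i * d))"
      using rec[of "l + Suc i * d" "j + Suc i * d"] j l by (simp add: algebra_simps)
    then show ?case using Suc by (simp add: algebra_simps)
  qed
  define \<delta> where "\<delta> = weight n (m - 1) - weight n m"
  have "\<delta> > 0" using weight_strict_decreasing[OF n(1), of "m - 1"] m_pos by (simp add: \<delta>_def)
  define s where "s i = (\<Sum>t\<le>i. weight n (m - 1 + t * d) - weight n (m + t * d))" for i
  have s: "\<delta> \<le> s i" for i
  proof -
    have "\<delta> = (\<Sum>t\<in>{0}. weight n (m - 1 + t * d) - weight n (m + t * d))" by (simp add: \<delta>_def)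
    also have "\<dots> \<le> s i" unfolding s_def
    proof (rule sum_mono2)
      show "0 \<le> weight n (m - 1 + t * d) - weight n (m + t * d)" for t
        using weight_strict_decreasing[OF n(1), of "m - 1 + t * d"] m_pos by simp
    qed auto
    finally show ?thesis .
  qed
  have "filterlim (\<lambda>t. t * d) sequentially sequentially"
    using degree_p by (intro filterlim_subseq) (simp add: strict_mono_def)
  from filterlim_compose[OF toeplitz_entry_slowly_varying[OF g, of "m - 1 + d" "n - 1"] this]
  have "(\<lambda>i. e (m - 1 + d + Suc (i * d)) (n - 1 + Suc (i * d)) - e (m - 1 + d + i * d) (n - 1 + i * d)) \<longlonglongrightarrow> 0"
    by (simp add: e_def)
  moreover have "e (m - 1 + d + Suc (i * d)) (n - 1 + Suc (i * d)) - e (m - 1 + d + i * d) (n - 1 + i * d) = - C * of_real (s i)" for i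
  proof -
    have "m - 1 + d + Suc (i * d) = m + Suc i * d" "n - 1 + Suc (i * d) = n + i * d"
      "m - 1 + d + i * d = m - 1 + Suc i * d"
      using m_pos n by auto
    then show ?thesis
      using chain[of m n i] chain[of "m - 1" "n - 1" i] n m_pos
      by (simp add: s_def sum_subtractf algebra_simps)
  qed
  ultimately have "(\<lambda>i. - C * of_real (s i)) \<longlonglongrightarrow> 0" by simp
  then have "(\<lambda>i. cmod (- C * of_real (s i))) \<longlonglongrightarrow> 0" by (rule tendsto_norm_zero)
  then have "cmod C * \<delta> \<le> 0"
  proof (rule LIMSEQ_le_const, intro exI allI impI)
    show "cmod C * \<delta> \<le> cmod (- C * of_real (s i))" for i
      using s[of i] \<open>\<delta> > 0\<close> by (simp add: norm_mult mult_left_mono)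
  qed
  then have "C = 0" using \<open>\<delta> > 0\<close> by (simp add: mult_le_0_iff)
  then show ?thesis using q_m lead by (simp add: C_def e_def)
qed

text \<open>
  With \<open>j = m - 2 + i\<close>, both sides of the recurrence are combinations of moments of a fixed function \<open>h\<close>
  with respect to powers of the squared modulus. The recurrence with the weights holds for \<open>i \<ge> 1\<close>, and
  extrapolation carries it to \<open>i = 0\<close>, where the true right-hand side is the other one.
\<close>

lemma top_degree_not_above:
  assumes g: "integrable disc_area g" and comm: "commutes (toeplitz_entry g)"
    and band: "band_le (int n) (toeplitz_entry g)" and n: "d < n" and m: "m \<ge> 2"
    and reg: "m \<ge> 3 \<or> (\<exists>B. AE w in disc_area. cmod (g w) \<le> B)"
  shows "toeplitz_entry g 0 n = 0"
proof -
  define e where "e = toeplitz_entry g"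
  define C where "C = e 0 n * q m / coeff p d"
  note rec = critical_recurrence[OF g e_def comm[folded e_def] band[folded e_def] _ C_def]
  \<comment> \<open>\<open>c - 1\<close> is the exponent of \<open>cnj w\<close> in \<open>h\<close>. For \<open>c = 0\<close> the factor \<open>c + i\<close> below vanishes at \<open>i = 0\<close>, in accordance with the missing second term of the recurrence.\<close>
  define c where "c = n - 1 - d"
  have n_eq: "n = c + d + 1" using n by (simp add: c_def)
  define h where "h w = g w * (w ^ (m - 2) * cnj w ^ c / cnj w)" for w
  have hm: "(\<lambda>w. w ^ (m - 2) * cnj w ^ c / cnj w) \<in> borel_measurable disc_area"
    by (intro borel_measurable_divide disc_area_measurable_continuous continuous_intros)
  have h: "integrable disc_area h"
  proof (cases "m \<ge> 3")
    case True
    show ?thesis unfolding h_def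
    proof (rule disc_bounded_mult_integrable[OF g hm, of 1])
      fix w assume w: "w \<in> unit_disc"
      have "cmod (w ^ (m - 2) / cnj w) \<le> 1"
      proof (cases "w = 0")
        case False
        have "m - 2 = Suc (m - 3)" using True by simp
        then have "cmod (w ^ (m - 2) / cnj w) = cmod w ^ (m - 3)" using False by (simp add: norm_divide norm_mult norm_power)
        then show ?thesis using w by (simp add: power_le_one)
      qed simp
      moreover have "cmod (cnj w ^ c) \<le> 1" using w by (simp add: norm_power power_le_one)
      ultimately have "cmod (w ^ (m - 2) / cnj w) * cmod (cnj w ^ c) \<le> 1" by (intro mult_le_one) auto
      then show "cmod (w ^ (m - 2) * cnj w ^ c / cnj w) \<le> 1" by (simp flip: norm_mult)
    qed
  next
    case False
    with reg obtain B where B: "AE w in disc_area. cmod (g w) \<le> B" by auto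
    show ?thesis
    proof (rule Bochner_Integration.integrable_bound[of _ "\<lambda>w. B * inverse (cmod w)"])
      show "integrable disc_area (\<lambda>w. B * inverse (cmod w))" using integrable_inverse_norm by simp
      show "h \<in> borel_measurable disc_area" unfolding h_def
        by (rule borel_measurable_times[OF borel_measurable_integrable[OF g] hm])
      show "AE w in disc_area. norm (h w) \<le> norm (B * inverse (cmod w))"
        using B AE_space
      proof eventually_elim
        case (elim w)
        have w: "cmod w < 1" using elim by (simp add: space_disc_area)
        have "cmod w ^ (m - 2) * cmod w ^ c \<le> 1" using w by (intro mult_le_one power_le_one) auto
        then have "cmod (g w) * (cmod w ^ (m - 2) * cmod w ^ c) \<le> B * 1"
          using elim by (intro mult_mono) (auto intro: order_trans[OF norm_ge_zero])
        then have "cmod (g w) * (cmod w ^ (m - 2) * cmod w ^ c) * inverse (cmod w) \<le> B * inverse (cmod w)"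
          by (intro mult_right_mono) auto
        then have "cmod (h w) \<le> B * inverse (cmod w)"
          by (simp add: h_def norm_mult norm_divide norm_power divide_inverse mult.assoc norm_inverse)
        then show ?case unfolding real_norm_def by (rule order_trans[OF _ abs_ge_self])
      qed
    qed
  qed
  have moment_h: "disc_moment h i i = disc_moment g (m - 2 + i) (c + i - 1)" if ci: "c + i \<ge> 1" for i
    unfolding disc_moment_def
  proof (rule integral_cong_AE)
    show "(\<lambda>w. h w * w ^ i * cnj w ^ i) \<in> borel_measurable disc_area"
      "(\<lambda>w. g w * w ^ (m - 2 + i) * cnj w ^ (c + i - 1)) \<in> borel_measurable disc_area"
      using disc_moment_integrable[OF h] disc_moment_integrable[OF g] by auto
    show "AE w in disc_area. h w * w ^ i * cnj w ^ i = g w * w ^ (m - 2 + i) * cnj w ^ (c + i - 1)"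
      using AE_disc_nonzero
    proof eventually_elim
      case (elim w)
      obtain s where s: "c + i = Suc s" using ci by (cases "c + i") auto
      have "cnj w ^ c * cnj w ^ i = cnj w * cnj w ^ s" by (simp flip: power_add add: s)
      then have "cnj w ^ c / cnj w * cnj w ^ i = cnj w ^ s" using elim by (simp add: field_simps)
      moreover have "h w * w ^ i * cnj w ^ i = g w * (w ^ (m - 2) * w ^ i) * (cnj w ^ c / cnj w * cnj w ^ i)"
        by (simp add: h_def)
      ultimately show ?case by (simp add: s power_add)
    qed
  qed
  have entry_h: "of_nat (c + i) * disc_moment h i i = (if c + i \<ge> 1 then e (m - 2 + i) (c + i - 1) else 0)" for i
  proof (cases "c + i \<ge> 1")
    case True
    then have "complex_of_nat (c + i - 1) + 1 = of_nat (c + i)" by (simp add: of_nat_diff)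
    then show ?thesis using True moment_h[OF True] by (simp add: e_def toeplitz_entry_def)
  next
    case False
    then have "c + i = 0" by simp
    then show ?thesis by (simp only:) simp
  qed
  define H1 where "H1 w = h w * (w ^ d * cnj w ^ d) - h w" for w
  let ?one = "\<lambda>i w. w ^ i * cnj w ^ i"
  define H0 where "H0 w = (of_nat (c + d) * (h w * (w ^ d * cnj w ^ d)) - of_nat c * h w)
      - C * of_nat m * (?one (m - 2) w - ?one (m - 2 + n) w)" for w
  have one: "integrable disc_area (?one i)" for i
    using disc_moment_integrable[of "\<lambda>_. 1" i i]
    by (simp add: finite_measure.integrable_const finite_measure_disc_area mult.assoc)
  have hd: "integrable disc_area (\<lambda>w. h w * (w ^ d * cnj w ^ d))"
    using disc_moment_integrable[OF h, of d d] by (simp add: mult.assoc)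
  have i1: "integrable disc_area (\<lambda>w. of_nat (c + d) * (h w * (w ^ d * cnj w ^ d)))"
    by (rule integrable_mult_right, rule hd)
  have i2: "integrable disc_area (\<lambda>w. of_nat c * h w)"
    by (rule integrable_mult_right, rule h)
  have i3: "integrable disc_area (\<lambda>w. C * of_nat m * (?one (m - 2) w - ?one (m - 2 + n) w))"
    by (rule integrable_mult_right, rule Bochner_Integration.integrable_diff; rule one)
  note i12 = Bochner_Integration.integrable_diff[OF i1 i2]
  have H1: "integrable disc_area H1"
    unfolding H1_def by (rule Bochner_Integration.integrable_diff[OF hd h])
  have H0: "integrable disc_area H0"
    unfolding H0_def by (rule Bochner_Integration.integrable_diff[OF i12 i3])
  have E: "disc_moment H0 i i + of_nat i * disc_moment H1 i i
      = (e (m - 2 + i + d) (n - 2 + i) - (if d \<le> n - 2 + i then e (m - 2 + i) (n - 2 + i - d) else 0))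
        - C * of_real (weight n (m - 2 + i))" for i
  proof -
    have m1: "disc_moment H1 i i = disc_moment h (i + d) (i + d) - disc_moment h i i"
      unfolding H1_def disc_moment_diff[OF hd h] disc_moment_times_monomial ..
    have one_m: "disc_moment (?one s) i i = 1 / (of_nat (i + s) + 1)" for s
      using disc_moment_times_monomial[of "\<lambda>_. 1" s s i i] by (simp add: disc_moment_one)
    have h_m: "disc_moment (\<lambda>w. h w * (w ^ d * cnj w ^ d)) i i = disc_moment h (i + d) (i + d)"
      by (rule disc_moment_times_monomial)
    have m0: "disc_moment H0 i i = (of_nat (c + d) * disc_moment h (i + d) (i + d) - of_nat c * disc_moment h i i)
        - C * of_nat m * (1 / (of_nat (i + (m - 2)) + 1) - 1 / (of_nat (i + (m - 2 + n)) + 1))"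
      unfolding H0_def disc_moment_diff[OF i12 i3] disc_moment_diff[OF i1 i2] disc_moment_cmult
        disc_moment_diff[OF one one] by (simp only: one_m h_m)
    have "disc_moment H0 i i + of_nat i * disc_moment H1 i i
      = (of_nat (c + (i + d)) * disc_moment h (i + d) (i + d) - of_nat (c + i) * disc_moment h i i)
        - C * of_nat m * (1 / (of_nat (i + (m - 2)) + 1) - 1 / (of_nat (i + (m - 2 + n)) + 1))"
      unfolding m0 m1 by (simp add: algebra_simps)
    also have "of_nat (c + (i + d)) * disc_moment h (i + d) (i + d) = e (m - 2 + i + d) (n - 2 + i)"
    proof -
      have "m - 2 + (i + d) = m - 2 + i + d" "c + (i + d) - 1 = n - 2 + i" "c + (i + d) \<ge> 1"
        using degree_p by (auto simp: n_eq)
      then show ?thesis using entry_h[of "i + d"] by (simp only: if_True)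
    qed
    also have "of_nat (c + i) * disc_moment h i i = (if d \<le> n - 2 + i then e (m - 2 + i) (n - 2 + i - d) else 0)"
    proof -
      have "c + i \<ge> 1 \<longleftrightarrow> d \<le> n - 2 + i" "c + i - 1 = n - 2 + i - d"
        using degree_p by (auto simp: n_eq)
      then show ?thesis using entry_h[of i] by (simp only:)
    qed
    also have "C * of_nat m * (1 / (of_nat (i + (m - 2)) + 1) - 1 / (of_nat (i + (m - 2 + n)) + 1)) = C * of_real (weight n (m - 2 + i))"
      by (simp add: weight_def algebra_simps)
    finally show ?thesis .
  qed
  have "disc_moment H0 0 0 = 0"
  proof (rule diagonal_moment_extrapolation[OF H0 H1])
    show "disc_moment H0 i i + of_nat i * disc_moment H1 i i = 0" if "i \<ge> 1" for i
    proof -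
      have "n - 2 + i + m = m - 2 + i + n" "m \<le> m - 2 + i + 1"
        using that m n degree_p by auto
      from rec(2)[OF this] show ?thesis unfolding E by simp
    qed
  qed
  then have "e (m - 2 + d) (n - 2) - (if d \<le> n - 2 then e (m - 2) (n - 2 - d) else 0) - C * of_real (weight n (m - 2)) = 0"
    using E[of 0] by (simp only: add_0_right of_nat_0 mult_zero_left)
  then have "e (m - 2 + d) (n - 2) - (if d \<le> n - 2 then e (m - 2) (n - 2 - d) else 0) = C * of_real (weight n (m - 2))"
    by (simp only: right_minus_eq)
  moreover have "n - 2 + m = m - 2 + n" "m - 2 < m" using m n degree_p by auto
  from rec(1)[OF this]
  have "e (m - 2 + d) (n - 2) - (if d \<le> n - 2 then e (m - 2) (n - 2 - d) else 0) = C * of_real (1 - real m / (real (m - 2) + real n + 1))" .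
  ultimately have "C * of_real (weight n (m - 2)) = C * of_real (1 - real m / (real (m - 2) + real n + 1))"
    by (simp only:)
  moreover have "weight n (m - 2) \<noteq> 1 - real m / (real (m - 2) + real n + 1)"
    using m by (simp add: weight_def of_nat_diff)
  ultimately have "C = 0" by (simp only: mult_cancel_left of_real_eq_iff) simp
  then show ?thesis using q_m lead by (simp add: C_def e_def)
qed

lemma top_degree_not_above_bounded:
  assumes g: "integrable disc_area g" and comm: "commutes (toeplitz_entry g)"
    and band: "band_le (int n) (toeplitz_entry g)" and n: "d < n" and m: "m = 1"
    and B: "AE w in disc_area. cmod (g w) \<le> B"
  shows "toeplitz_entry g 0 n = 0"
proof -
  define e where "e = toeplitz_entry g"
  define C where "C = e 0 n * q m / coeff p d"
  note rec = critical_recurrence[OF g e_def comm[folded e_def] band[folded e_def] _ C_def]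
  define k where "k = n - 1 - d"
  have n_eq: "n = k + d + 1" using n by (simp add: k_def)
  have "C = 0"
  proof (rule diagonal_moment_nonresonance[OF g B degree_p, of n k])
    show "n > 0" using n by simp
    fix j
    have "j + d + k + m = j + n" "m \<le> j + 1" using m by (auto simp: n_eq)
    from rec(2)[OF this] have "e (j + d) (j + d + k) - e j (j + k) = C * of_real (weight n j)" by simp
    moreover have "complex_of_real (weight n j) = 1 / (of_nat j + 1) - 1 / (of_nat j + of_nat n + 1)"
      unfolding weight_def by (simp add: m)
    ultimately show "toeplitz_entry g (j + d) (j + d + k) - toeplitz_entry g j (j + k)
      = C * (1 / (of_nat j + 1) - 1 / (of_nat j + of_nat n + 1))"
      by (simp add: e_def)
  qed
  then show ?thesis using q_m lead by (simp add: C_def e_def)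
qed

section \<open>Lowering the top diagonal\<close>

lemma commutes_diff_cmult:
  assumes "commutes A" "commutes B"
  shows "commutes (\<lambda>j l. A j l - c * B j l)"
proof -
  from assms obtain K K' where
    "\<And>L j l. L \<ge> j + K \<Longrightarrow> mat_prod L symbol_entry A j l = mat_prod L A symbol_entry j l"
    "\<And>L j l. L \<ge> j + K' \<Longrightarrow> mat_prod L symbol_entry B j l = mat_prod L B symbol_entry j l"
    unfolding commutes_def by blast
  moreover have "mat_prod L symbol_entry (\<lambda>j l. A j l - c * B j l) j l = mat_prod L symbol_entry A j l - c * mat_prod L symbol_entry B j l"
    "mat_prod L (\<lambda>j l. A j l - c * B j l) symbol_entry j l = mat_prod L A symbol_entry j l - c * mat_prod L B symbol_entry j l" for L j l
    by (simp_all add: mat_prod_def algebra_simps sum_subtractf sum_distrib_left)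
  ultimately show ?thesis
    unfolding commutes_def by (intro exI[of _ "K + K'"]) simp
qed

lemma commutes_symbol_entry: "commutes symbol_entry"
  unfolding commutes_def by blast

lemma commutes_identity: "commutes (analytic_matrix 1)"
  unfolding commutes_def
proof (intro exI[of _ d] allI impI)
  fix L j l :: nat assume L: "j + d \<le> L"
  have I: "analytic_matrix 1 a b = (if a = b then 1 else 0)" for a b
    by (auto simp: analytic_matrix_def)
  have "mat_prod L symbol_entry (analytic_matrix 1) j l = (if l \<le> L then symbol_entry j l else 0)"
    by (simp add: mat_prod_def I if_distrib cong: if_cong)
  moreover have "mat_prod L (analytic_matrix 1) symbol_entry j l = symbol_entry j l"
    using L by (simp add: mat_prod_def I if_distrib if_distribR cong: if_cong)
  moreover have "symbol_entry j l = 0" if "\<not> l \<le> L"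
    using that L band_leD[OF band_symbol_entry, of l j] by simp
  ultimately show "mat_prod L symbol_entry (analytic_matrix 1) j l = mat_prod L (analytic_matrix 1) symbol_entry j l" by auto
qed

text \<open>
  The hypotheses on the symbol \<open>g\<close> that survive subtraction of multiples of \<open>f\<close> and of constants,
  with \<open>n\<close> as a bound for the top diagonal.
\<close>

definition admissible :: "(complex \<Rightarrow> complex) \<Rightarrow> int \<Rightarrow> bool"
  where "admissible u n \<longleftrightarrow> integrable disc_area u \<and> (m \<ge> 3 \<or> (\<exists>B. AE w in disc_area. cmod (u w) \<le> B))
    \<and> commutes (toeplitz_entry u) \<and> band_le n (toeplitz_entry u)"

lemma top_diagonal_constant:
  assumes "admissible u (int n)"
  shows "toeplitz_entry u j (j + n) = toeplitz_entry u 0 n"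
proof -
  have "band_le (int n) (\<lambda>j l. toeplitz_entry u j l - analytic_matrix 0 j l)"
    using assms by (simp add: admissible_def)
  from diagonal_constant[OF _ refl _ _ this, of 0] assms obtain \<gamma>
    where "\<And>j l. int l - int j = int n \<Longrightarrow> toeplitz_entry u j l = \<gamma>"
    by (auto simp: admissible_def)
  then show ?thesis by simp
qed

lemma band_le_pred:
  assumes "band_le (int n) A" "\<And>j. A j (j + n) = 0"
  shows "band_le (int n - 1) A"
  unfolding band_le_def
proof (intro allI impI)
  fix j l assume "int l - int j > int n - 1"
  then consider "int l - int j > int n" | "l = j + n" by linarith
  then show "A j l = 0" using assms by cases (auto simp: band_le_def)
qed

lemma admissible_descend:
  assumes u: "admissible u (int n)" and n: "n > 0" "n \<noteq> d"
  shows "admissible u (int n - 1)"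
proof -
  have g: "integrable disc_area u" "commutes (toeplitz_entry u)" "band_le (int n) (toeplitz_entry u)"
    and reg: "m \<ge> 3 \<or> (\<exists>B. AE w in disc_area. cmod (u w) \<le> B)"
    using u by (auto simp: admissible_def)
  consider "n < d" | "d < n" "m \<ge> 2" | "d < n" "m = 1" using n m_pos by linarith
  then have "toeplitz_entry u 0 n = 0"
  proof cases
    case 1 then show ?thesis using top_degree_not_below[OF g n(1)] by simp
  next
    case 2 then show ?thesis using top_degree_not_above[OF g] reg by simp
  next
    case 3
    then obtain B where "AE w in disc_area. cmod (u w) \<le> B" using reg by auto
    then show ?thesis using top_degree_not_above_bounded[OF g 3] by simp
  qed
  then have "band_le (int n - 1) (toeplitz_entry u)"
    using top_diagonal_constant[OF u] by (intro band_le_pred g) simp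
  then show ?thesis using u by (simp add: admissible_def)
qed

lemma admissible_diff_cmult:
  assumes u: "admissible u (int n)" and v: "admissible v (int n)"
    and top: "toeplitz_entry u 0 n = c * toeplitz_entry v 0 n"
  shows "admissible (\<lambda>w. u w - c * v w) (int n - 1)"
proof -
  have int: "integrable disc_area u" "integrable disc_area v" using u v by (auto simp: admissible_def)
  have entry: "toeplitz_entry (\<lambda>w. u w - c * v w) = (\<lambda>j l. toeplitz_entry u j l - c * toeplitz_entry v j l)"
    by (intro ext toeplitz_entry_diff_cmult int)
  have "band_le (int n - 1) (\<lambda>j l. toeplitz_entry u j l - c * toeplitz_entry v j l)"
  proof (rule band_le_pred)
    show "band_le (int n) (\<lambda>j l. toeplitz_entry u j l - c * toeplitz_entry v j l)"
      using u v by (simp add: admissible_def band_le_def)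
    show "toeplitz_entry u j (j + n) - c * toeplitz_entry v j (j + n) = 0" for j
      unfolding top_diagonal_constant[OF u] top_diagonal_constant[OF v] top by simp
  qed
  moreover have "\<exists>B. AE w in disc_area. cmod (u w - c * v w) \<le> B" if "\<not> m \<ge> 3"
  proof -
    from u v that obtain B B' where "AE w in disc_area. cmod (u w) \<le> B" "AE w in disc_area. cmod (v w) \<le> B'"
      by (auto simp: admissible_def)
    then have "AE w in disc_area. cmod (u w - c * v w) \<le> B + cmod c * B'"
    proof eventually_elim
      case (elim w)
      then have "cmod (c * v w) \<le> cmod c * B'" by (simp add: norm_mult mult_left_mono)
      then show ?case using elim by (intro norm_triangle_le_diff add_mono)
    qed
    then show ?thesis by blast
  qed
  ultimately show ?thesis
    using u v int by (auto simp: admissible_def entry intro!: commutes_diff_cmult)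
qed

text \<open>
  Lower the top diagonal to \<open>d\<close>, subtract a multiple of \<open>f\<close>, lower it to \<open>0\<close>, and subtract a constant.
\<close>

lemma admissible_reduction:
  assumes g: "admissible g (int n)"
    and f: "admissible f (int d)" and ff: "toeplitz_entry f = symbol_entry"
  shows "\<exists>a b. AE w in disc_area. g w = a * f w + b"
proof -
  have "admissible g (int d)"
  proof (cases "n \<ge> d")
    case True
    have "admissible g (int (n - t))" if "t \<le> n - d" for t
      using that
    proof (induction t)
      case (Suc t)
      then have "n - t > 0" "n - t \<noteq> d" and eq: "int (n - Suc t) = int (n - t) - 1"
        using degree_p by auto
      then show ?case unfolding eq using Suc by (intro admissible_descend) auto
    qed (use g in simp)
    from this[of "n - d"] show ?thesis using True by simp
  next
    case False
    then show ?thesis using g by (auto simp: admissible_def band_le_def)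
  qed
  moreover define a where "a = toeplitz_entry g 0 d / coeff p d"
  ultimately have "admissible (\<lambda>w. g w - a * f w) (int d - 1)"
    using f lead symbol_entry_top[of 0] by (intro admissible_diff_cmult) (simp_all add: ff)
  then have u: "admissible (\<lambda>w. g w - a * f w) (int (d - 1))"
    using degree_p by (simp add: of_nat_diff)
  define u where "u w = g w - a * f w" for w
  have "admissible u (int (d - 1 - t))" if "t \<le> d - 1" for t
    using that
  proof (induction t)
    case (Suc t)
    then have "d - 1 - t > 0" "d - 1 - t \<noteq> d" and eq: "int (d - 1 - Suc t) = int (d - 1 - t) - 1"
      by auto
    then show ?case unfolding eq using Suc by (intro admissible_descend) auto
  qed (use u in \<open>simp add: u_def[abs_def]\<close>)
  from this[of "d - 1"] have u0: "admissible u (int 0)" by simp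
  have one_entry: "toeplitz_entry (\<lambda>_. 1) = analytic_matrix 1"
    using toeplitz_entry_poly[of "\<lambda>_. 1" 1] by (auto simp: fun_eq_iff analytic_matrix_def)
  have one: "admissible (\<lambda>_. 1) (int 0)"
    unfolding admissible_def one_entry
    using commutes_identity band_analytic[of 1 0] finite_measure.integrable_const[OF finite_measure_disc_area]
    by (auto intro!: exI[of _ 1])
  define b where "b = toeplitz_entry u 0 0"
  have "admissible (\<lambda>w. u w - b * 1) (int 0 - 1)"
    using u0 one by (intro admissible_diff_cmult) (simp_all add: b_def one_entry analytic_matrix_def)
  then have v: "admissible (\<lambda>w. u w - b) (- 1)" by simp
  then have "toeplitz_entry (\<lambda>w. u w - b) j l = 0" for j l
    using negative_band_vanishes[of "\<lambda>w. u w - b" "-1"] by (simp add: admissible_def)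
  then have "disc_moment (\<lambda>w. u w - b) j l = 0" for j l
    by (simp add: toeplitz_entry_eq_0_iff)
  then have "moment_free (\<lambda>w. u w - b)"
    using v by (simp add: moment_free_def admissible_def)
  from moment_free_AE_zero[OF this] have "AE w in disc_area. g w = a * f w + b"
    by eventually_elim (simp add: u_def algebra_simps)
  then show ?thesis by blast
qed

end

lemma monomial_in_bergman_space: "(\<lambda>w. w ^ j) \<in> bergman_space"
proof -
  have "integrable disc_area (\<lambda>w. (cmod (w ^ j))\<^sup>2)"
    by (intro disc_bounded_integrable[of _ 1] disc_area_measurable_continuous continuous_intros)
      (simp add: norm_power power_le_one)
  then show ?thesis by (auto simp: bergman_space_def intro!: holomorphic_intros)
qed

section \<open>The commutant theorem\<close>

text \<open>
  The commutation hypothesis is evaluated on monomials only. Their images under \<open>T\<^sub>f\<close> are polynomials,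
  hence bounded, so on all functions involved the extension \<open>S\<close> is given by the integral formula.
\<close>

theorem theorem3:
  fixes f f2 g :: "complex \<Rightarrow> complex"
    and p :: "complex poly"
    and m :: nat
    and S :: "(complex \<Rightarrow> complex) \<Rightarrow> (complex \<Rightarrow> complex)"
  assumes "bounded (f ` unit_disc)"
    and "harmonic_on f unit_disc"
    and "m > 0"
    and "degree p > 0"
    and "f2 holomorphic_on unit_disc"
    and "f2 0 \<noteq> 0"
    and "\<And>z. z \<in> unit_disc \<Longrightarrow> f z = poly p z + cnj z ^ m * cnj (f2 z)"
    and "integrable disc_area g"
    and "right_terminating g"
    and "is_toeplitz_extension g S"
    and "\<And>h z. h \<in> bergman_space \<Longrightarrow> z \<in> unit_disc \<Longrightarrow>
           S (toeplitz f h) z - toeplitz f (S h) z = 0"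
    and "m \<ge> 3 \<or> essentially_bounded g"
  shows "\<exists>a b. AE z in disc_area. g z = a * f z + b"
proof -
  note f_eq = assms(7) and g_int = assms(8)
  obtain q where q: "q m \<noteq> 0" "\<And>i. i < m \<Longrightarrow> q i = 0"
    and entry_f: "\<And>j l. toeplitz_entry f j l
      = (if j \<le> l then coeff p (l - j) else q (j - l) * (of_nat l + 1) / (of_nat j + 1))"
    using toeplitz_entry_harmonic[OF assms(1,5,6,3) f_eq] by metis
  interpret harmonic_symbol p q m
    using assms(3,4) q by unfold_locales
  have symbol_entry: "toeplitz_entry f = symbol_entry"
    by (auto simp: fun_eq_iff entry_f symbol_entry_def analytic_matrix_def coanalytic_matrix_def)
  obtain Bf where Bf: "\<And>w. w \<in> unit_disc \<Longrightarrow> cmod (f w) \<le> Bf"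
    using assms(1) by (metis bounded_iff imageI)
  have f2c: "continuous_on unit_disc f2"
    using assms(5) by (rule holomorphic_on_imp_continuous_on)
  have "continuous_on unit_disc (\<lambda>z. poly p z + cnj z ^ m * cnj (f2 z))"
    by (intro continuous_intros f2c)
  then have fc: "continuous_on unit_disc f"
    by (rule continuous_on_eq) (simp add: f_eq)
  have f_int: "integrable disc_area f"
    using Bf by (intro disc_bounded_integrable[of _ Bf] disc_area_measurable_continuous fc)
  obtain n0 where "\<And>j l. int l - int j > n0 \<Longrightarrow> disc_moment g j l = 0"
    using right_terminating_moment_eq_0[OF assms(9)] by metis
  then have band_g: "band_le (int (nat n0)) (toeplitz_entry g)"
    by (simp add: band_le_def toeplitz_entry_def)
  have S: "S h z = toeplitz g h z" if "h holomorphic_on unit_disc" "bounded (h ` unit_disc)" "z \<in> unit_disc" for h z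
    using assms(10) that by (auto simp: is_toeplitz_extension_def)
  have poly_image: "bounded (\<phi> ` unit_disc)" if "continuous_on (cball 0 1) \<phi>" for \<phi> :: "complex \<Rightarrow> complex"
    using compact_imp_bounded[OF compact_continuous_image[OF that compact_cball]]
    by (rule bounded_subset) auto
  have comm: "toeplitz g (toeplitz f (\<lambda>w. w ^ j)) z = toeplitz f (toeplitz g (\<lambda>w. w ^ j)) z" if z: "z \<in> unit_disc" for j z
  proof -
    let ?P = "\<lambda>w. \<Sum>l\<le>j + d. toeplitz_entry f j l * w ^ l"
    have P: "toeplitz f (\<lambda>w. w ^ j) w = ?P w" if "w \<in> unit_disc" for w
      using that band_leD[OF band_symbol_entry] by (intro toeplitz_monomial_eq_poly f_int) (simp_all add: symbol_entry)
    have "?P holomorphic_on unit_disc" by (intro holomorphic_intros)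
    then have hol: "toeplitz f (\<lambda>w. w ^ j) holomorphic_on unit_disc"
      by (rule holomorphic_transform) (simp add: P)
    have "toeplitz f (\<lambda>w. w ^ j) ` unit_disc = ?P ` unit_disc"
      by (rule image_cong[OF refl P])
    moreover have "bounded (?P ` unit_disc)"
      by (intro poly_image continuous_intros)
    ultimately have "bounded (toeplitz f (\<lambda>w. w ^ j) ` unit_disc)" by simp
    then have "S (toeplitz f (\<lambda>w. w ^ j)) z = toeplitz g (toeplitz f (\<lambda>w. w ^ j)) z"
      by (rule S[OF hol _ z])
    moreover have "toeplitz f (S (\<lambda>w. w ^ j)) z = toeplitz f (toeplitz g (\<lambda>w. w ^ j)) z"
      by (intro toeplitz_cong S holomorphic_intros poly_image continuous_intros)
    ultimately show ?thesis
      using assms(11)[OF monomial_in_bergman_space z, of j] by simp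
  qed
  have "commutes (toeplitz_entry g)"
    unfolding commutes_def
  proof (intro exI[of _ "d + nat n0"] allI impI)
    fix L j l assume "j + (d + nat n0) \<le> L"
    moreover have "toeplitz_entry f i k = 0" if "k > i + d" for i k
      unfolding symbol_entry using that by (intro band_leD[OF band_symbol_entry]) linarith
    moreover have "toeplitz_entry g i k = 0" if "k > i + nat n0" for i k
      using that by (intro band_leD[OF band_g]) linarith
    ultimately have "mat_prod L (toeplitz_entry f) (toeplitz_entry g) j l = mat_prod L (toeplitz_entry g) (toeplitz_entry f) j l"
      by (intro toeplitz_commute_entries[OF f_int g_int _ _ comm, where d = d and n = "nat n0"]) auto
    then show "mat_prod L symbol_entry (toeplitz_entry g) j l = mat_prod L (toeplitz_entry g) symbol_entry j l"
      by (simp only: symbol_entry)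
  qed
  moreover have "m \<ge> 3 \<or> (\<exists>B. AE w in disc_area. cmod (g w) \<le> B)"
    using assms(12) by (auto simp: essentially_bounded_def)
  ultimately have "admissible g (int (nat n0))"
    using g_int band_g by (simp add: admissible_def)
  moreover have "admissible f (int d)"
    unfolding admissible_def symbol_entry using f_int commutes_symbol_entry band_symbol_entry Bf
    by (auto intro!: exI[of _ Bf] AE_I2 simp: space_disc_area)
  ultimately show ?thesis
    using symbol_entry by (rule admissible_reduction)
qed

end
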